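(* Let $p\ge1$ and let $f\in\mathfrak W^{p\times p}$ be such that $f(Z)>0$ for every $Z\in\partial\mathbb K$. Then $f$ admits a spectral factorization $f(Z)=f_+(Z)f_+(Z)^*$, $Z\in\partial\mathbb K$, where $f_+^{\pm1}\in\mathfrak W_+^{p\times p}$.
   Context: $\mathbb{BC}$ is the commutative algebra of bicomplex numbers $Z=z_1+jz_2$, $z_1,z_2\in\mathbb C$ (imaginary unit $i$), where $j^2=-1$ and $ij=ji=:k$ (so $k^2=1$). Put $\mathbf e_1=\frac{1+k}{2}$, $\mathbf e_2=\frac{1-k}{2}$; these are idempotents with $\mathbf e_1\mathbf e_2=0$, $\mathbf e_1+\mathbf e_2=1$, and every $Z=z_1+jz_2$ is uniquely $Z=\lambda_1\mathbf e_1+\lambda_2\mathbf e_2$ with $\lambda_1=z_1-iz_2$, $\lambda_2=z_1+iz_2\in\mathbb C$. Similarly every $M\in\mathbb{BC}^{p\times p}$ is uniquely $M=M_1\mathbf e_1+M_2\mathbf e_2$ with $M_1,M_2\in\mathbb C^{p\times p}$, sums and products being componentwise; its norm is $\|M\|=\|M_1\|+\|M_2\|$ (operator norms of complex matrices). The conjugate of $Z=z_1+jz_2$ is $Z^*=\overline{z_1}-j\overline{z_2}=\overline{\lambda_1}\mathbf e_1+\overline{\lambda_2}\mathbf e_2$, and $M^*$ is the transpose of $M$ with this conjugation applied entrywise, i.e. $M^*=M_1^*\mathbf e_1+M_2^*\mathbf e_2$. $M>0$ means that both $M_1$ and $M_2$ are (strictly) positive definite complex matrices. The bicomplex unit circle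 is $\partial\mathbb K=\{e^{it}e^{js}: t,s\in[0,2\pi]\}\subset\mathbb{BC}$, where $e^{js}=\cos s+j\sin s$ (equivalently the set of $Z$ with $|\lambda_1|=|\lambda_2|=1$). The bicomplex Wiener algebra $\mathfrak W^{p\times p}$ consists of the functions on $\partial\mathbb K$ of the form $f(Z)=\sum_{n\in\mathbb Z}f_nZ^n$ with $f_n\in\mathbb{BC}^{p\times p}$ and $\sum_{n\in\mathbb Z}\|f_n\|<\infty$, with pointwise multiplication. $\mathfrak W_+^{p\times p}$ is the subalgebra of those $f$ of the form $\sum_{n\ge0}f_nZ^n$. $f_+^{-1}$ denotes the pointwise inverse. *)

theory Defs
  imports "HOL-Analysis.Analysis"
begin

section \<open>Bicomplex numbers\<close>

text \<open>\<open>Bicomplex z\<^sub>1 z\<^sub>2\<close> stands for \<open>z\<^sub>1 + j z\<^sub>2\<close>.\<close>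

datatype bicomplex = Bicomplex (bc1: complex) (bc2: complex)

lemma bicomplex_eq_iff: "Z = W \<longleftrightarrow> bc1 Z = bc1 W \<and> bc2 Z = bc2 W"
  by (cases Z; cases W) simp

instantiation bicomplex :: comm_ring_1
begin

definition "0 = Bicomplex 0 0"
definition "1 = Bicomplex 1 0"
definition "Z + W = Bicomplex (bc1 Z + bc1 W) (bc2 Z + bc2 W)"
definition "- Z = Bicomplex (- bc1 Z) (- bc2 Z)"
definition "Z - W = Bicomplex (bc1 Z - bc1 W) (bc2 Z - bc2 W)"
definition "Z * W = Bicomplex (bc1 Z * bc1 W - bc2 Z * bc2 W) (bc1 Z * bc2 W + bc2 Z * bc1 W)"

instance
  by standard
    (simp_all add: bicomplex_eq_iff zero_bicomplex_def one_bicomplex_def plus_bicomplex_def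
      uminus_bicomplex_def minus_bicomplex_def times_bicomplex_def algebra_simps)

end

lemma bc_sel_simps [simp]:
  "bc1 0 = 0" "bc2 0 = 0" "bc1 1 = 1" "bc2 1 = 0"
  "bc1 (Z + W) = bc1 Z + bc1 W" "bc2 (Z + W) = bc2 Z + bc2 W"
  "bc1 (- Z) = - bc1 Z" "bc2 (- Z) = - bc2 Z"
  "bc1 (Z - W) = bc1 Z - bc1 W" "bc2 (Z - W) = bc2 Z - bc2 W"
  "bc1 (Z * W) = bc1 Z * bc1 W - bc2 Z * bc2 W"
  "bc2 (Z * W) = bc1 Z * bc2 W + bc2 Z * bc1 W"
  by (simp_all add: zero_bicomplex_def one_bicomplex_def plus_bicomplex_def
      uminus_bicomplex_def minus_bicomplex_def times_bicomplex_def)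

definition bc_of_complex :: "complex \<Rightarrow> bicomplex"
  where "bc_of_complex z = Bicomplex z 0"

definition bc_j :: bicomplex where "bc_j = Bicomplex 0 1"

definition bc_k :: bicomplex where "bc_k = bc_of_complex \<i> * bc_j"

definition bc_e1 :: bicomplex where "bc_e1 = bc_of_complex (1 / 2) * (1 + bc_k)"

definition bc_e2 :: bicomplex where "bc_e2 = bc_of_complex (1 / 2) * (1 - bc_k)"

text \<open>The idempotent components \<open>\<lambda>\<^sub>1\<close>, \<open>\<lambda>\<^sub>2\<close>.\<close>

definition bc_lam1 :: "bicomplex \<Rightarrow> complex" where "bc_lam1 Z = bc1 Z - \<i> * bc2 Z"

definition bc_lam2 :: "bicomplex \<Rightarrow> complex" where "bc_lam2 Z = bc1 Z + \<i> * bc2 Z"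

lemmas bc_unit_defs = bc_of_complex_def bc_j_def bc_k_def bc_e1_def bc_e2_def

lemma bc_units:
  "bc_j * bc_j = -1" "bc_k * bc_k = 1"
  "bc_e1 * bc_e1 = bc_e1" "bc_e2 * bc_e2 = bc_e2" "bc_e1 * bc_e2 = 0" "bc_e1 + bc_e2 = 1"
  by (simp_all add: bicomplex_eq_iff bc_unit_defs)

lemma bc_algebraic_form: "Z = bc_of_complex (bc1 Z) + bc_j * bc_of_complex (bc2 Z)"
  by (simp add: bicomplex_eq_iff bc_unit_defs)

lemma bc_idempotent_form:
  "Z = bc_of_complex (bc_lam1 Z) * bc_e1 + bc_of_complex (bc_lam2 Z) * bc_e2"
  by (simp add: bicomplex_eq_iff bc_unit_defs bc_lam1_def bc_lam2_def field_simps)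

lemma bc_idempotent_unique:
  "bc_lam1 (bc_of_complex a * bc_e1 + bc_of_complex b * bc_e2) = a"
  "bc_lam2 (bc_of_complex a * bc_e1 + bc_of_complex b * bc_e2) = b"
  by (simp_all add: bc_unit_defs bc_lam1_def bc_lam2_def field_simps)

lemma bc_eq_iff_lam: "Z = W \<longleftrightarrow> bc_lam1 Z = bc_lam1 W \<and> bc_lam2 Z = bc_lam2 W"
  by (metis bc_idempotent_form)

lemma bc_lam_simps [simp]:
  "bc_lam1 0 = 0" "bc_lam2 0 = 0" "bc_lam1 1 = 1" "bc_lam2 1 = 1"
  "bc_lam1 (Z + W) = bc_lam1 Z + bc_lam1 W" "bc_lam2 (Z + W) = bc_lam2 Z + bc_lam2 W"
  "bc_lam1 (- Z) = - bc_lam1 Z" "bc_lam2 (- Z) = - bc_lam2 Z"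
  "bc_lam1 (Z - W) = bc_lam1 Z - bc_lam1 W" "bc_lam2 (Z - W) = bc_lam2 Z - bc_lam2 W"
  "bc_lam1 (Z * W) = bc_lam1 Z * bc_lam1 W" "bc_lam2 (Z * W) = bc_lam2 Z * bc_lam2 W"
  by (simp_all add: bc_lam1_def bc_lam2_def algebra_simps)

text \<open>The inverse is the genuine one on units (\<open>\<lambda>\<^sub>1 \<lambda>\<^sub>2 = z\<^sub>1\<^sup>2 + z\<^sub>2\<^sup>2 \<noteq> 0\<close>) and \<open>0\<close> on non-units; it makes
  integer powers \<open>powi\<close> available.\<close>

instantiation bicomplex :: inverse
begin

definition "inverse Z = Bicomplex (bc1 Z / ((bc1 Z)\<^sup>2 + (bc2 Z)\<^sup>2)) (- bc2 Z / ((bc1 Z)\<^sup>2 + (bc2 Z)\<^sup>2))"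
definition "Z div W = Z * inverse (W :: bicomplex)"

instance ..

end

lemma bc_lam_mult: "bc_lam1 Z * bc_lam2 Z = (bc1 Z)\<^sup>2 + (bc2 Z)\<^sup>2"
  by (simp add: bc_lam1_def bc_lam2_def algebra_simps power2_eq_square)

lemma bc_inverse_right:
  assumes "bc_lam1 Z \<noteq> 0" "bc_lam2 Z \<noteq> 0"
  shows "Z * inverse Z = 1"
proof -
  have "(bc1 Z)\<^sup>2 + (bc2 Z)\<^sup>2 \<noteq> 0"
    using assms bc_lam_mult[of Z] by (metis mult_eq_0_iff)
  then show ?thesis
    by (simp add: bicomplex_eq_iff inverse_bicomplex_def flip: add_divide_distrib)
       (simp add: power2_eq_square flip: add_divide_distrib)
qed

instantiation bicomplex :: real_algebra
begin

definition "r *\<^sub>R Z = Bicomplex (r *\<^sub>R bc1 Z) (r *\<^sub>R bc2 Z)"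

instance
  by standard (simp_all add: bicomplex_eq_iff scaleR_bicomplex_def algebra_simps)

end

text \<open>The norm is \<open>\<bar>\<lambda>\<^sub>1\<bar> + \<bar>\<lambda>\<^sub>2\<bar>\<close>; it induces the usual topology.\<close>

instantiation bicomplex :: real_normed_algebra
begin

definition "norm Z = cmod (bc_lam1 Z) + cmod (bc_lam2 Z)"
definition "sgn Z = Z /\<^sub>R norm (Z :: bicomplex)"
definition "dist Z W = norm (Z - W :: bicomplex)"
definition [code del]:
  "(uniformity :: (bicomplex \<times> bicomplex) filter) = (INF e\<in>{0 <..}. principal {(x, y). dist x y < e})"
definition [code del]:
  "open (U :: bicomplex set) \<longleftrightarrow> (\<forall>x\<in>U. eventually (\<lambda>(x', y). x' = x \<longrightarrow> y \<in> U) uniformity)"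

instance
proof
  fix a :: real and Z W :: bicomplex
  have lam: "bc_lam1 (a *\<^sub>R Z) = a *\<^sub>R bc_lam1 Z" "bc_lam2 (a *\<^sub>R Z) = a *\<^sub>R bc_lam2 Z"
    by (simp_all add: scaleR_bicomplex_def bc_lam1_def bc_lam2_def algebra_simps)
  show "norm (a *\<^sub>R Z) = \<bar>a\<bar> * norm Z"
    by (simp add: norm_bicomplex_def lam distrib_left)
  show "norm Z = 0 \<longleftrightarrow> Z = 0"
    by (simp add: norm_bicomplex_def add_nonneg_eq_0_iff bc_eq_iff_lam)
  show "norm (Z + W) \<le> norm Z + norm W"
    using norm_triangle_ineq[of "bc_lam1 Z" "bc_lam1 W"]
      norm_triangle_ineq[of "bc_lam2 Z" "bc_lam2 W"]
    by (simp add: norm_bicomplex_def)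
  show "norm (Z * W) \<le> norm Z * norm W"
    by (simp add: norm_bicomplex_def norm_mult algebra_simps)
qed (simp_all add: sgn_bicomplex_def dist_bicomplex_def uniformity_bicomplex_def open_bicomplex_def)

end

definition bc_cnj :: "bicomplex \<Rightarrow> bicomplex"
  where "bc_cnj Z = Bicomplex (cnj (bc1 Z)) (- cnj (bc2 Z))"

lemma bc_lam_cnj:
  "bc_lam1 (bc_cnj Z) = cnj (bc_lam1 Z)" "bc_lam2 (bc_cnj Z) = cnj (bc_lam2 Z)"
  by (simp_all add: bc_cnj_def bc_lam1_def bc_lam2_def)

text \<open>The bicomplex unit circle, with \<open>e\<^bsup>it\<^esup> = cis t\<close> and \<open>e\<^bsup>js\<^esup> = cos s + j sin s\<close>.\<close>

definition bc_circle :: "bicomplex set"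
  where "bc_circle = {bc_of_complex (cis t) * Bicomplex (of_real (cos s)) (of_real (sin s)) |t s.
    t \<in> {0..2 * pi} \<and> s \<in> {0..2 * pi}}"

lemma bc_circle_norm1:
  assumes "Z \<in> bc_circle"
  shows "cmod (bc_lam1 Z) = 1" "cmod (bc_lam2 Z) = 1"
proof -
  obtain t s where Z: "Z = bc_of_complex (cis t) * Bicomplex (of_real (cos s)) (of_real (sin s))"
    using assms by (auto simp: bc_circle_def)
  have "bc_lam1 Z = cis t * cis (- s)" "bc_lam2 Z = cis t * cis s"
    by (simp_all add: Z bc_of_complex_def bc_lam1_def bc_lam2_def complex_eq_iff)
  then show "cmod (bc_lam1 Z) = 1" "cmod (bc_lam2 Z) = 1"
    by (simp_all add: norm_mult)
qed

section \<open>Bicomplex matrices\<close>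

definition bc_mat1 :: "bicomplex^'n^'m \<Rightarrow> complex^'n^'m"
  where "bc_mat1 M = map_matrix bc_lam1 M"

definition bc_mat2 :: "bicomplex^'n^'m \<Rightarrow> complex^'n^'m"
  where "bc_mat2 M = map_matrix bc_lam2 M"

text \<open>This is not the library norm of \<open>bicomplex^'n^'m\<close>, which is a different (equivalent) norm.\<close>

definition bc_mat_norm :: "bicomplex^'n^'m \<Rightarrow> real"
  where "bc_mat_norm M = onorm ((*v) (bc_mat1 M)) + onorm ((*v) (bc_mat2 M))"

definition bc_adjoint :: "bicomplex^'n^'m \<Rightarrow> bicomplex^'m^'n"
  where "bc_adjoint M = transpose (map_matrix bc_cnj M)"

text \<open>Over the complex numbers, real-valuedness of the quadratic form already forces the matrix to be
  Hermitian.\<close>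

definition complex_pos_def :: "complex^'n^'n \<Rightarrow> bool"
  where "complex_pos_def A \<longleftrightarrow>
    (\<forall>x. x \<noteq> 0 \<longrightarrow> (\<Sum>i\<in>UNIV. cnj (x $ i) * (A *v x) $ i) \<in> \<real> \<and>
                   0 < Re (\<Sum>i\<in>UNIV. cnj (x $ i) * (A *v x) $ i))"

definition bc_pos_def :: "bicomplex^'n^'n \<Rightarrow> bool"
  where "bc_pos_def M \<longleftrightarrow> complex_pos_def (bc_mat1 M) \<and> complex_pos_def (bc_mat2 M)"

section \<open>The bicomplex Wiener algebra\<close>

text \<open>Functions on the circle are represented by total functions whose values off the circle are
  irrelevant.\<close>

definition wiener_series ::
  "(int \<Rightarrow> bicomplex^'p^'p) \<Rightarrow> (bicomplex \<Rightarrow> bicomplex^'p^'p) \<Rightarrow> bool"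
  where "wiener_series c f \<longleftrightarrow>
    (\<lambda>n. bc_mat_norm (c n)) summable_on UNIV \<and>
    (\<forall>Z\<in>bc_circle. ((\<lambda>n. map_matrix (\<lambda>a. a * Z powi n) (c n)) has_sum f Z) UNIV)"

definition wiener :: "(bicomplex \<Rightarrow> bicomplex^'p^'p) set"
  where "wiener = {f. \<exists>c. wiener_series c f}"

definition wiener_plus :: "(bicomplex \<Rightarrow> bicomplex^'p^'p) set"
  where "wiener_plus = {f. \<exists>c. wiener_series c f \<and> (\<forall>n<0. c n = 0)}"

end

theory Submission
  imports Defs
begin

text \<open>In the idempotent components the problem splits into two spectral factorizations over \<open>\<complex>\<close>. For a positive
  definite \<open>f\<close> in the complex matrix Wiener algebra the Toeplitz form of \<open>f\<close> is coercive on \<open>\<ell>\<^sup>2\<close>. Because the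
  coefficients of \<open>f\<close> are summable, commuting with slowly varying exponential weights upgrades coercivity to an \<open>\<ell>\<^sup>1\<close>
  bound for the finite sections that is uniform in their size, so the finite section method solves the Toeplitz
  equation with right-hand side \<open>\<delta>\<^sub>0\<close> in \<open>\<ell>\<^sup>1\<close>. Its solution \<open>g\<close> makes \<open>g\<^sup>* f g\<close> constant, and both \<open>g\<close> and \<open>f g\<close>
  are one-sided series, which yields the factorization without Wiener's lemma or Fredholm theory.\<close>

section \<open>The Wiener algebra of the unit circle\<close>

text \<open>Coercivity alone yields only a square-summable solution, which need not be a Wiener
  series. The bridge is a family of l2 norms with weights centred at k: coercivity controls each of
  them, and their sum over k is comparable to the l1 norm with constants independent of the section.
  The weight must decay for that sum to converge, yet so slowly that its commutator with the
  convolution costs only a fraction of the coercivity constant.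

  Invertibility of the factor is never shown by inverting a series: up to adjoints and a constant
  matrix, \<open>f g\<close> is the pointwise inverse of \<open>g\<close>, and both are given as
  Wiener series from the outset.

  The reduction to two complex problems is faithful because the first idempotent component of
  \<open>f Z\<close> depends only on \<open>bc_lam1 Z\<close> and the second only on
  \<open>bc_lam2 Z\<close>; both are therefore visible at the points whose two components
  agree.\<close>

definition wiener_coeffs :: "(int \<Rightarrow> complex) \<Rightarrow> (complex \<Rightarrow> complex) \<Rightarrow> bool"
  where "wiener_coeffs c g \<longleftrightarrow> (\<lambda>n. cmod (c n)) summable_on UNIV \<and>
    (\<forall>z. cmod z = 1 \<longrightarrow> ((\<lambda>n. c n * z powi n) has_sum g z) UNIV)"

lemma wiener_coeffsD:
  assumes "wiener_coeffs c g"
  shows "(\<lambda>n. cmod (c n)) summable_on UNIV" "cmod z = 1 \<Longrightarrow> ((\<lambda>n. c n * z powi n) has_sum g z) UNIV"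
  using assms by (auto simp: wiener_coeffs_def)

lemma wiener_coeffs_cong:
  assumes "wiener_coeffs c g" "\<And>n. c n = d n" "\<And>z. cmod z = 1 \<Longrightarrow> g z = h z"
  shows "wiener_coeffs d h"
proof -
  have "c = d" using assms(2) by auto
  then show ?thesis using assms by (auto simp: wiener_coeffs_def)
qed

lemma cmod_powi_circle: "cmod z = 1 \<Longrightarrow> cmod (z powi n) = 1"
  by (simp add: norm_power_int)

lemma wiener_coeffs_monomial: "wiener_coeffs (\<lambda>n. if n = k then a else 0) (\<lambda>z. a * z powi k)"
  unfolding wiener_coeffs_def
proof (intro conjI allI impI)
  show "(\<lambda>n. cmod (if n = k then a else 0)) summable_on UNIV"
    by (rule finite_nonzero_values_imp_summable_on) (auto intro: finite_subset[of _ "{k}"])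
  show "((\<lambda>n. (if n = k then a else 0) * z powi n) has_sum a * z powi k) UNIV" for z
    by (rule has_sum_finite_neutralI[of "{k}"]) auto
qed

lemma wiener_coeffs_zero: "wiener_coeffs (\<lambda>n. 0) (\<lambda>z. 0)"
  by (simp add: wiener_coeffs_def)

lemma wiener_coeffs_add:
  assumes "wiener_coeffs c g" "wiener_coeffs d h"
  shows "wiener_coeffs (\<lambda>n. c n + d n) (\<lambda>z. g z + h z)"
  unfolding wiener_coeffs_def
proof (intro conjI allI impI)
  have "(\<lambda>n. cmod (c n) + cmod (d n)) summable_on UNIV"
    by (intro summable_on_add wiener_coeffsD(1)[OF assms(1)] wiener_coeffsD(1)[OF assms(2)])
  then show "(\<lambda>n. cmod (c n + d n)) summable_on UNIV"
    by (rule summable_on_comparison_test) (auto intro: norm_triangle_ineq)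
  show "((\<lambda>n. (c n + d n) * z powi n) has_sum g z + h z) UNIV" if "cmod z = 1" for z
    unfolding distrib_right by (intro has_sum_add wiener_coeffsD(2) assms that)
qed

lemma wiener_coeffs_cmult:
  assumes "wiener_coeffs c g"
  shows "wiener_coeffs (\<lambda>n. a * c n) (\<lambda>z. a * g z)"
  using assms unfolding wiener_coeffs_def
  by (auto simp: norm_mult mult.assoc intro!: summable_on_cmult_right has_sum_cmult_right)

lemma wiener_coeffs_sum:
  assumes "\<And>i. i \<in> I \<Longrightarrow> wiener_coeffs (c i) (g i)"
  shows "wiener_coeffs (\<lambda>n. \<Sum>i\<in>I. c i n) (\<lambda>z. \<Sum>i\<in>I. g i z)"
  using assms
  by (induction I rule: infinite_finite_induct) (auto intro: wiener_coeffs_zero wiener_coeffs_add)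

lemma wiener_coeffs_shift:
  assumes "wiener_coeffs c g"
  shows "wiener_coeffs (\<lambda>n. c (n - k)) (\<lambda>z. z powi k * g z)"
  unfolding wiener_coeffs_def
proof (intro conjI allI impI)
  show "(\<lambda>n. cmod (c (n - k))) summable_on UNIV"
    using wiener_coeffsD(1)[OF assms]
    by (subst summable_on_reindex_bij_witness[of _ "\<lambda>n. n + k" "\<lambda>n. n - k" UNIV "\<lambda>n. cmod (c n)"]) auto
  fix z :: complex assume z: "cmod z = 1"
  then have nz: "z \<noteq> 0" by auto
  have "((\<lambda>n. z powi k * (c n * z powi n)) has_sum z powi k * g z) UNIV"
    by (intro has_sum_cmult_right wiener_coeffsD(2) assms z)
  also have "?this \<longleftrightarrow> ((\<lambda>n. c (n - k) * z powi n) has_sum z powi k * g z) UNIV"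
    by (rule has_sum_reindex_bij_witness[of _ "\<lambda>n. n - k" "\<lambda>n. n + k"])
       (auto simp: power_int_add nz)
  finally show "((\<lambda>n. c (n - k) * z powi n) has_sum z powi k * g z) UNIV" .
qed

lemma cnj_powi_circle:
  assumes "cmod z = 1"
  shows "cnj z powi n = z powi (- n)" "cnj (z powi n) = z powi (- n)"
proof -
  have "cnj z = inverse z"
    using assms complex_norm_square[of z] by (simp add: inverse_unique)
  then show "cnj z powi n = z powi (- n)"
    by (simp add: power_int_minus power_int_inverse)
  then show "cnj (z powi n) = z powi (- n)" by (simp add: power_int_def split: if_splits)
qed

lemma wiener_coeffs_cnj:
  assumes "wiener_coeffs c g"
  shows "wiener_coeffs (\<lambda>n. cnj (c (- n))) (\<lambda>z. cnj (g z))"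
  unfolding wiener_coeffs_def
proof (intro conjI allI impI)
  show "(\<lambda>n. cmod (cnj (c (- n)))) summable_on UNIV"
    using wiener_coeffsD(1)[OF assms]
    by (subst summable_on_reindex_bij_witness[of _ "\<lambda>n. - n" "\<lambda>n. - n" UNIV "\<lambda>n. cmod (c n)"]) auto
  fix z :: complex assume z: "cmod z = 1"
  have "((\<lambda>n. cnj (c n * z powi n)) has_sum cnj (g z)) UNIV"
    using wiener_coeffsD(2)[OF assms z] by (simp only: has_sum_cnj_iff)
  also have "?this \<longleftrightarrow> ((\<lambda>n. cnj (c (- n)) * z powi n) has_sum cnj (g z)) UNIV"
    by (rule has_sum_reindex_bij_witness[of _ "\<lambda>n. - n" "\<lambda>n. - n"])
       (auto simp: cnj_powi_circle z)
  finally show "((\<lambda>n. cnj (c (- n)) * z powi n) has_sum cnj (g z)) UNIV" .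
qed

text \<open>On the circle \<open>cnj z\<close> is \<open>1 / z\<close>, so reflecting the argument
  reverses the index. The values themselves are not conjugated, only taken at another point, so
  pointwise positivity survives.\<close>

lemma wiener_coeffs_reflect:
  assumes "wiener_coeffs c g"
  shows "wiener_coeffs (\<lambda>n. c (- n)) (\<lambda>z. g (cnj z))"
  unfolding wiener_coeffs_def
proof (intro conjI allI impI)
  show "(\<lambda>n. cmod (c (- n))) summable_on UNIV"
    using wiener_coeffsD(1)[OF assms]
    by (subst summable_on_reindex_bij_witness[of _ "\<lambda>n. - n" "\<lambda>n. - n" UNIV "\<lambda>n. cmod (c n)"]) auto
  fix z :: complex assume z: "cmod z = 1"
  have "((\<lambda>n. c n * cnj z powi n) has_sum g (cnj z)) UNIV"
    using wiener_coeffsD(2)[OF assms, of "cnj z"] z by simp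
  also have "?this \<longleftrightarrow> ((\<lambda>n. c (- n) * z powi n) has_sum g (cnj z)) UNIV"
    by (rule has_sum_reindex_bij_witness[of _ "\<lambda>n. - n" "\<lambda>n. - n"])
       (auto simp: cnj_powi_circle z)
  finally show "((\<lambda>n. c (- n) * z powi n) has_sum g (cnj z)) UNIV" .
qed

text \<open>Cauchy product. The shear \<open>(n, m) \<mapsto> (n - m, m)\<close> carries the
  absolutely summable product family to the convolution terms; summing the same double series in
  both arrangements identifies the value.\<close>

lemma wiener_coeffs_mult:
  assumes "wiener_coeffs c g" "wiener_coeffs d h"
  shows "wiener_coeffs (\<lambda>n. \<Sum>\<^sub>\<infinity>m. c (n - m) * d m) (\<lambda>z. g z * h z)"
proof -
  have c: "(\<lambda>n. cmod (c n)) summable_on UNIV" and d: "(\<lambda>n. cmod (d n)) summable_on UNIV"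
    using assms by (auto dest: wiener_coeffsD)
  have "(\<lambda>(n, m). cmod (c n * d m)) summable_on UNIV \<times> UNIV"
  proof (rule summable_on_SigmaI)
    show "((\<lambda>m. case (n, m) of (n, m) \<Rightarrow> cmod (c n * d m)) has_sum cmod (c n) * (\<Sum>\<^sub>\<infinity>m. cmod (d m))) UNIV" for n
      using d by (auto simp: norm_mult intro!: has_sum_cmult_right)
    show "(\<lambda>n. cmod (c n) * (\<Sum>\<^sub>\<infinity>m. cmod (d m))) summable_on UNIV"
      using c by (intro summable_on_cmult_left)
  qed auto
  also have "?this \<longleftrightarrow> (\<lambda>(n, m). cmod (c (n - m) * d m)) summable_on UNIV \<times> UNIV"
    by (rule summable_on_reindex_bij_witness[of _ "\<lambda>(n, m). (n - m, m)" "\<lambda>(n, m). (n + m, m)"]) auto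
  finally have abs: "(\<lambda>(n, m). cmod (c (n - m) * d m)) summable_on UNIV \<times> UNIV" .
  have row: "(\<lambda>m. cmod (c (n - m) * d m)) summable_on UNIV" for n
    using summable_on_SigmaD1[OF abs, of n] by simp
  have abs2: "(\<lambda>n. \<Sum>\<^sub>\<infinity>m. cmod (c (n - m) * d m)) summable_on UNIV"
    using summable_on_Sigma_banach[OF abs] by simp
  show ?thesis
    unfolding wiener_coeffs_def
  proof (intro conjI allI impI)
    show "(\<lambda>n. cmod (\<Sum>\<^sub>\<infinity>m. c (n - m) * d m)) summable_on UNIV"
      by (rule summable_on_comparison_test[OF abs2]) (auto intro: norm_infsum_bound row)
    fix z :: complex assume z: "cmod z = 1"
    then have nz: "z \<noteq> 0" by auto
    let ?F = "\<lambda>(n, m). (c (n - m) * d m) * z powi n"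
    have "(\<lambda>x. cmod (?F x)) summable_on UNIV \<times> UNIV"
      using abs by (simp add: case_prod_unfold norm_mult cmod_powi_circle z)
    then have sF: "?F summable_on UNIV \<times> UNIV" by (rule abs_summable_summable)
    have F: "(?F has_sum (\<Sum>\<^sub>\<infinity>x\<in>UNIV \<times> UNIV. ?F x)) (UNIV \<times> UNIV)"
      using sF by (rule has_sum_infsum)
    have "((\<lambda>(n, m). (c n * z powi n) * (d m * z powi m)) has_sum (\<Sum>\<^sub>\<infinity>x\<in>UNIV \<times> UNIV. ?F x)) (UNIV \<times> UNIV)"
      using F by (subst has_sum_reindex_bij_witness[of _ "\<lambda>(n, m). (n - m, m)" "\<lambda>(n, m). (n + m, m)" _ ?F])
         (auto simp: power_int_add nz)
    then have "((\<lambda>n. (c n * z powi n) * h z) has_sum (\<Sum>\<^sub>\<infinity>x\<in>UNIV \<times> UNIV. ?F x)) UNIV"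
      by (rule has_sum_SigmaD) (auto intro!: has_sum_cmult_right wiener_coeffsD(2) assms z)
    moreover have "((\<lambda>n. (c n * z powi n) * h z) has_sum g z * h z) UNIV"
      by (intro has_sum_cmult_left wiener_coeffsD(2) assms z)
    ultimately have "(\<Sum>\<^sub>\<infinity>x\<in>UNIV \<times> UNIV. ?F x) = g z * h z"
      by (rule has_sum_unique)
    with F have "(?F has_sum g z * h z) (UNIV \<times> UNIV)" by simp
    then show "((\<lambda>n. (\<Sum>\<^sub>\<infinity>m. c (n - m) * d m) * z powi n) has_sum g z * h z) UNIV"
      by (rule has_sum_SigmaD)
        (auto intro!: has_sum_cmult_left has_sum_infsum abs_summable_summable row)
  qed
qed

section \<open>Continuity on the circle and Fourier coefficients\<close>

lemma wiener_coeffs_continuous: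
  assumes "wiener_coeffs c g"
  shows "continuous_on (sphere 0 1) g"
proof -
  have "uniform_limit (sphere 0 1) (\<lambda>X z. \<Sum>n\<in>X. c n * z powi n) g (finite_subsets_at_top UNIV)"
    by (rule Weierstrass_m_test_general'[OF _ wiener_coeffsD(2)[OF assms] wiener_coeffsD(1)[OF assms]])
       (auto simp: norm_mult cmod_powi_circle)
  then show ?thesis
    by (rule uniform_limit_theorem[rotated])
       (auto intro!: always_eventually continuous_intros)
qed

lemma has_integral_cis:
  assumes "n \<noteq> (0::int)"
  shows "((\<lambda>t. cis (of_int n * t)) has_integral 0) {0..2 * pi}"
proof -
  have "((\<lambda>t. cis (of_int n * t)) has_integral
      (cis (of_int n * (2 * pi)) / (\<i> * of_int n) - cis (of_int n * 0) / (\<i> * of_int n))) {0..2 * pi}"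
    using assms by (intro fundamental_theorem_of_calculus)
      (auto simp: cis_conv_exp mult.commute[of _ "\<i>"] intro!: derivative_eq_intros has_vector_derivative_real_field)
  also have "cis (of_int n * (2 * pi)) = 1"
    by (metis cis_multiple_2pi mult.commute Ints_of_int)
  finally show ?thesis by simp
qed

text \<open>\<open>c 0\<close> is the mean of \<open>g\<close> over the circle. Only a finite
  partial sum uniformly within \<open>e\<close> of \<open>g\<close> is integrated, which avoids
  interchanging sum and integral.\<close>

lemma wiener_coeffs_mean_nonneg:
  assumes "wiener_coeffs c g" "\<And>z. cmod z = 1 \<Longrightarrow> 0 \<le> Re (g z)"
  shows "0 \<le> Re (c 0)"
proof (rule field_le_epsilon)
  fix e :: real assume e: "e > 0"
  have "uniform_limit (sphere 0 1) (\<lambda>X z. \<Sum>n\<in>X. c n * z powi n) g (finite_subsets_at_top UNIV)"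
    by (rule Weierstrass_m_test_general'[OF _ wiener_coeffsD(2)[OF assms(1)] wiener_coeffsD(1)[OF assms(1)]])
       (auto simp: norm_mult cmod_powi_circle)
  then have "\<forall>\<^sub>F X in finite_subsets_at_top UNIV. \<forall>z\<in>sphere 0 1. dist (\<Sum>n\<in>X. c n * z powi n) (g z) < e"
    using e by (auto simp: uniform_limit_iff)
  then obtain X0 where X0: "finite X0"
    "\<And>Y. finite Y \<Longrightarrow> X0 \<subseteq> Y \<Longrightarrow> \<forall>z\<in>sphere 0 1. dist (\<Sum>n\<in>Y. c n * z powi n) (g z) < e"
    by (auto simp: eventually_finite_subsets_at_top)
  \<comment> \<open>Index 0 is forced in, so that the integral of the partial sum is exactly
    \<open>c 0 * (2 * pi)\<close>.\<close>
  define X where "X = insert 0 X0"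
  have X: "finite X" "0 \<in> X" "\<And>z. cmod z = 1 \<Longrightarrow> cmod ((\<Sum>n\<in>X. c n * z powi n) - g z) < e"
    using X0(1) X0(2)[of X, OF _ subset_insertI[of X0 0, folded X_def]] by (auto simp: X_def dist_norm)
  have "((\<lambda>t. \<Sum>n\<in>X. c n * cis (of_int n * t)) has_integral (\<Sum>n\<in>X. c n * (if n = 0 then 2 * pi else 0))) {0..2 * pi}"
  proof (intro has_integral_sum has_integral_mult_right X)
    fix n assume "n \<in> X"
    have "((\<lambda>t::real. 1::complex) has_integral of_real (2 * pi)) {0..2 * pi}"
      using has_integral_const_real[of "1::complex" 0 "2 * pi"] by (simp add: scaleR_conv_of_real)
    then show "((\<lambda>t. cis (of_int n * t)) has_integral complex_of_real (if n = 0 then 2 * pi else 0)) {0..2 * pi}"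
      using has_integral_cis[of n] by auto
  qed
  also have "(\<Sum>n\<in>X. c n * complex_of_real (if n = 0 then 2 * pi else 0)) = c 0 * (2 * pi)"
    using X by (subst sum.remove[of _ 0]) (auto intro!: sum.neutral)
  finally have I1: "((\<lambda>t. Re (\<Sum>n\<in>X. c n * cis (of_int n * t))) has_integral Re (c 0 * (2 * pi))) {0..2 * pi}"
    using has_integral_linear[OF _ bounded_linear_Re] unfolding o_def by blast
  have I2: "((\<lambda>t::real. - e) has_integral (- e * (2 * pi))) {0..2 * pi}"
    using has_integral_const_real[of "- e" 0 "2 * pi"] by (simp add: mult.commute)
  have I3: "- e \<le> Re (\<Sum>n\<in>X. c n * cis (of_int n * t))" for t
  proof -
    have p: "cis (of_int n * t) = cis t powi n" for n
      by (simp add: cis_power_int)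
    have "\<bar>Re ((\<Sum>n\<in>X. c n * cis t powi n) - g (cis t))\<bar> < e"
      using X(3)[of "cis t"] abs_Re_le_cmod by (meson norm_cis order_le_less_trans)
    moreover have "0 \<le> Re (g (cis t))" by (rule assms(2)) simp
    ultimately show ?thesis unfolding p by (simp only: minus_complex.sel)
  qed
  have "(- e) * (2 * pi) \<le> Re (c 0 * (2 * pi))"
    by (rule has_integral_le[OF I2 I1 I3])
  also have "Re (c 0 * (2 * pi)) = Re (c 0) * (2 * pi)" by simp
  finally have "- e \<le> Re (c 0)"
    by (rule mult_right_le_imp_le) simp
  then show "0 \<le> Re (c 0) + e" by simp
qed

text \<open>Shifting by \<open>- n\<close> and scaling by \<open>a\<close> moves
  \<open>a * c n\<close> to index 0. The mean of the zero function then gives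
  \<open>0 \<le> Re (a * c n)\<close> for every \<open>a\<close>, and the four units 1, -1, i, -i
  already force \<open>c n = 0\<close>.\<close>

lemma wiener_coeffs_zero_unique:
  assumes "wiener_coeffs c g" "\<And>z. cmod z = 1 \<Longrightarrow> g z = 0"
  shows "c n = 0"
proof -
  have *: "0 \<le> Re (a * c n)" for a
    using wiener_coeffs_mean_nonneg[OF wiener_coeffs_shift[OF wiener_coeffs_cmult[OF assms(1)], of a "- n"]]
    by (simp add: assms(2))
  show ?thesis
    using *[of 1] *[of "-1"] *[of \<i>] *[of "- \<i>"] by (simp add: complex_eq_iff)
qed

lemma wiener_coeffs_unique:
  assumes "wiener_coeffs c g" "wiener_coeffs d h" "\<And>z. cmod z = 1 \<Longrightarrow> g z = h z"
  shows "c n = d n"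
  using wiener_coeffs_zero_unique[OF wiener_coeffs_add[OF assms(1) wiener_coeffs_cmult[OF assms(2), of "-1"]], of n]
  by (simp add: assms(3))

section \<open>Coercive convolution equations on the half-line\<close>

lemma summable_on_exp_abs_int:
  fixes e :: real
  assumes "e > 0"
  shows "(\<lambda>k::int. exp (- e * \<bar>of_int k\<bar>)) summable_on UNIV"
proof -
  have "summable (\<lambda>n. exp (- e) ^ n)"
    using assms by (intro summable_geometric) simp
  then have nat: "(\<lambda>n::nat. exp (- e * n)) summable_on UNIV"
    by (subst summable_on_UNIV_nonneg_real_iff) (auto simp: mult.commute simp flip: exp_of_nat_mult)
  have "(\<lambda>k::int. exp (- e * \<bar>of_int k\<bar>)) summable_on range int"
    using nat by (subst summable_on_reindex) (auto simp: o_def inj_on_def)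
  moreover have "(\<lambda>k::int. exp (- e * \<bar>of_int k\<bar>)) summable_on range (\<lambda>n. - int n)"
    using nat by (subst summable_on_reindex) (auto simp: o_def inj_on_def)
  ultimately have "(\<lambda>k::int. exp (- e * \<bar>of_int k\<bar>)) summable_on (range int \<union> range (\<lambda>n. - int n))"
    by (rule summable_on_union)
  moreover have "range int \<union> range (\<lambda>n. - int n) = UNIV"
    by (auto simp: image_iff) (metis int_cases2)
  ultimately show ?thesis by simp
qed

lemma has_sum_sum:
  fixes f :: "'i \<Rightarrow> 'a \<Rightarrow> 'b::topological_comm_monoid_add"
  assumes "\<And>i. i \<in> I \<Longrightarrow> (f i has_sum s i) A"
  shows "((\<lambda>x. \<Sum>i\<in>I. f i x) has_sum (\<Sum>i\<in>I. s i)) A"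
  using assms by (induction I rule: infinite_finite_induct) (auto intro: has_sum_add)

lemma L2_set_sum_le: "L2_set (\<lambda>n. \<Sum>d\<in>T. t d n) S \<le> (\<Sum>d\<in>T. L2_set (t d) S)"
proof (induction T rule: infinite_finite_induct)
  case (insert d T)
  have "L2_set (\<lambda>n. \<Sum>d\<in>insert d T. t d n) S \<le> L2_set (t d) S + L2_set (\<lambda>n. \<Sum>d\<in>T. t d n) S"
    using insert by (simp add: L2_set_triangle_ineq)
  with insert show ?case by simp
qed (simp_all add: L2_set_0')

text \<open>All mass of \<open>g\<close> sits in \<open>S\<close>; a shift can only push some of it
  out of the window.\<close>

lemma L2_set_shift_le:
  fixes g :: "int \<Rightarrow> real"
  assumes "finite S" "\<And>m. m \<notin> S \<Longrightarrow> g m = 0"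
  shows "L2_set (\<lambda>n. g (n - d)) S \<le> L2_set g S"
proof -
  have "(\<Sum>n\<in>S. (g (n - d))\<^sup>2) = (\<Sum>m\<in>(\<lambda>n. n - d) ` S. (g m)\<^sup>2)"
    by (subst sum.reindex) (auto simp: inj_on_def)
  also have "\<dots> = (\<Sum>m\<in>(\<lambda>n. n - d) ` S \<inter> S. (g m)\<^sup>2)"
    using assms by (intro sum.mono_neutral_right) auto
  also have "\<dots> \<le> (\<Sum>m\<in>S. (g m)\<^sup>2)"
    using assms by (intro sum_mono2) auto
  finally show ?thesis by (simp add: L2_set_def)
qed

text \<open>The quotient of the two weights lies between \<open>exp (- (e * d))\<close> and
  \<open>exp (e * d)\<close>. Since \<open>2 \<le> t + 1 / t\<close>, the same constant
  \<open>exp (e * d) - 1\<close> bounds the difference in both directions, and it tends to 0 with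
  \<open>e\<close> for fixed \<open>d\<close>.\<close>

lemma exp_weight_diff_le:
  fixes e :: real and p q d :: int
  assumes "e > 0" "\<bar>p - q\<bar> \<le> d"
  shows "\<bar>exp (- e * \<bar>of_int p\<bar>) - exp (- e * \<bar>of_int q\<bar>)\<bar> \<le> (exp (e * d) - 1) * exp (- e * \<bar>of_int p\<bar>)"
proof -
  let ?p = "\<bar>real_of_int p\<bar>" and ?q = "\<bar>real_of_int q\<bar>" and ?d = "real_of_int d"
  have d: "0 \<le> ?d" "?p \<le> ?q + ?d" "?q \<le> ?p + ?d" using assms(2) by linarith+
  have "exp (- e * ?q) \<le> exp (e * ?d + - e * ?p)"
    using mult_left_mono[OF d(2), of e] assms(1) by (simp add: algebra_simps)
  then have 1: "exp (- e * ?q) \<le> exp (e * ?d) * exp (- e * ?p)" by (simp only: exp_add)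
  have "exp (- (e * ?d) + - e * ?p) \<le> exp (- e * ?q)"
    using mult_left_mono[OF d(3), of e] assms(1) by (simp add: algebra_simps)
  then have 2: "exp (- (e * ?d)) * exp (- e * ?p) \<le> exp (- e * ?q)" by (simp only: exp_add)
  have "0 \<le> (exp (e * ?d) - 1)\<^sup>2" by simp
  then have "2 \<le> exp (e * ?d) + exp (- (e * ?d))"
    by (simp add: exp_minus field_simps power2_eq_square)
  then have "2 * exp (- e * ?p) \<le> (exp (e * ?d) + exp (- (e * ?d))) * exp (- e * ?p)"
    by (intro mult_right_mono) auto
  with 1 2 show ?thesis unfolding abs_le_iff by (simp add: algebra_simps)
qed

text \<open>Test the coercive form on \<open>y n = w (n - k) x n\<close>. The commutator of the convolution with the weight is split
  into its diagonals \<open>d\<close>: for small \<open>\<bar>d\<bar>\<close> the weight hardly varies, for large \<open>\<bar>d\<bar>\<close> the coefficient \<open>h d\<close> is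
  small and the crude bound by \<open>u k + u (k - d)\<close> suffices, because it is shift-invariant after summation over \<open>k\<close>.\<close>

lemma weighted_section_estimate:
  fixes a :: "int \<Rightarrow> 'v::real_inner \<Rightarrow> 'v" and h :: "int \<Rightarrow> real" and x :: "int \<Rightarrow> 'v" and D :: int
  assumes fin: "finite S" and h: "\<And>n. 0 \<le> h n" and lin: "\<And>n. linear (a n)"
    and bound: "\<And>n v. norm (a n v) \<le> h n * norm v" and "e > 0" and D: "0 \<le> D"
    and coercive: "\<And>y. \<delta> * (\<Sum>n\<in>S. (norm (y n))\<^sup>2) \<le> (\<Sum>n\<in>S. inner (y n) (\<Sum>m\<in>S. a (n - m) (y m)))"
  defines "w \<equiv> \<lambda>n::int. exp (- e * \<bar>of_int n\<bar>)"
  defines "u \<equiv> \<lambda>k. L2_set (\<lambda>n. w (n - k) * norm (x n)) S"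
  defines "T \<equiv> (\<lambda>(n, m). n - m) ` (S \<times> S)"
  shows "\<delta> * u k \<le> L2_set (\<lambda>n. w (n - k) * norm (\<Sum>m\<in>S. a (n - m) (x m))) S
    + (exp (e * D) - 1) * (\<Sum>d\<in>{d\<in>T. \<bar>d\<bar> \<le> D}. h d) * u k
    + (\<Sum>d\<in>{d\<in>T. \<bar>d\<bar> > D}. h d * (u k + u (k - d)))"
    (is "_ \<le> ?\<beta> + ?near + ?far")
proof -
  interpret lin: linear "a n" for n by (rule lin)
  have finT: "finite T" using fin by (auto simp: T_def)
  have w0: "0 \<le> w n" for n by (simp add: w_def)
  have u0: "0 \<le> u k" for k by (simp add: u_def)
  define b where "b n = (\<Sum>m\<in>S. a (n - m) (x m))" for n
  define y where "y n = w (n - k) *\<^sub>R x n" for n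
  \<comment> \<open>The commutator of weight and convolution: applying the convolution to
    \<open>y\<close> gives \<open>w (n - k) *\<^sub>R b n + r n\<close>.\<close>
  define r where "r n = (\<Sum>m\<in>S. (w (m - k) - w (n - k)) *\<^sub>R a (n - m) (x m))" for n
  \<comment> \<open>Zero extension of the norms, so that a shift out of \<open>S\<close> picks up no
    stray values of \<open>x\<close>.\<close>
  define \<xi> where "\<xi> m = (if m \<in> S then norm (x m) else 0)" for m
  have \<xi>0: "0 \<le> \<xi> m" for m by (simp add: \<xi>_def)
  have u_alt: "u k = L2_set (\<lambda>n. w (n - k) * \<xi> n) S" for k
    unfolding u_def by (intro L2_set_cong) (auto simp: \<xi>_def)
  have near0: "0 \<le> ?near" using D h u0 \<open>e > 0\<close> by (auto intro!: mult_nonneg_nonneg sum_nonneg)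
  have far0: "0 \<le> ?far" using h u0 by (auto intro!: mult_nonneg_nonneg sum_nonneg add_nonneg_nonneg)
  have shift: "L2_set (\<lambda>n. w (n - d - k) * \<xi> (n - d)) S \<le> u k" for d k
    unfolding u_alt by (rule L2_set_shift_le[OF fin, of "\<lambda>m. w (m - k) * \<xi> m"]) (auto simp: \<xi>_def)
  \<comment> \<open>Bounds the part of \<open>r n\<close> on the diagonal
    \<open>n - m = d\<close>.\<close>
  define t where "t d n = h d * (\<bar>w (n - d - k) - w (n - k)\<bar> * \<xi> (n - d))" for d n
  have norm_r: "norm (r n) \<le> (\<Sum>d\<in>T. t d n)" if n: "n \<in> S" for n
  proof -
    have "norm (r n) \<le> (\<Sum>m\<in>S. t (n - m) n)"
      unfolding r_def
    proof (rule sum_norm_le)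
      fix m assume m: "m \<in> S"
      have "norm ((w (m - k) - w (n - k)) *\<^sub>R a (n - m) (x m)) \<le>
          \<bar>w (m - k) - w (n - k)\<bar> * (h (n - m) * norm (x m))"
        using bound by (auto intro!: mult_left_mono)
      also have "\<dots> = t (n - m) n" using m by (simp add: t_def \<xi>_def)
      finally show "norm ((w (m - k) - w (n - k)) *\<^sub>R a (n - m) (x m)) \<le> t (n - m) n" .
    qed
    also have "\<dots> = (\<Sum>d\<in>(\<lambda>m. n - m) ` S. t d n)"
      by (subst sum.reindex) (auto simp: inj_on_def)
    also have "\<dots> \<le> (\<Sum>d\<in>T. t d n)"
      using n h \<xi>0 by (intro sum_mono2 finT) (auto simp: T_def t_def)
    finally show ?thesis .
  qed
  have near: "L2_set (t d) S \<le> h d * ((exp (e * D) - 1) * u k)" if d: "\<bar>d\<bar> \<le> D" for d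
  proof -
    have "L2_set (t d) S \<le> L2_set (\<lambda>n. h d * ((exp (e * D) - 1) * (w (n - d - k) * \<xi> (n - d)))) S"
    proof (rule L2_set_mono)
      fix n
      have "\<bar>w (n - d - k) - w (n - k)\<bar> \<le> (exp (e * D) - 1) * w (n - d - k)"
        unfolding w_def using \<open>e > 0\<close> d by (intro exp_weight_diff_le) auto
      then have "\<bar>w (n - d - k) - w (n - k)\<bar> * \<xi> (n - d) \<le> (exp (e * D) - 1) * w (n - d - k) * \<xi> (n - d)"
        by (rule mult_right_mono) (rule \<xi>0)
      then show "t d n \<le> h d * ((exp (e * D) - 1) * (w (n - d - k) * \<xi> (n - d)))"
        unfolding t_def mult.assoc by (rule mult_left_mono) (rule h)
      show "0 \<le> t d n" using h \<xi>0 by (simp add: t_def)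
    qed
    also have "\<dots> = h d * ((exp (e * D) - 1) * L2_set (\<lambda>n. w (n - d - k) * \<xi> (n - d)) S)"
      using \<open>e > 0\<close> D h by (simp add: L2_set_right_distrib)
    also have "\<dots> \<le> h d * ((exp (e * D) - 1) * u k)"
      using \<open>e > 0\<close> D h shift by (intro mult_left_mono) auto
    finally show ?thesis .
  qed
  have far: "L2_set (t d) S \<le> h d * (u k + u (k - d))" for d
  proof -
    \<comment> \<open>Writing \<open>w (n - k)\<close> as \<open>w (n - d - (k - d))\<close>
      exhibits it as a shifted weight centred at \<open>k - d\<close>; this is the origin of
      \<open>u (k - d)\<close>.\<close>
    have "L2_set (t d) S \<le> L2_set (\<lambda>n. h d * (w (n - d - k) * \<xi> (n - d) + w (n - d - (k - d)) * \<xi> (n - d))) S"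
    proof (rule L2_set_mono)
      fix n
      have "\<bar>w (n - d - k) - w (n - k)\<bar> \<le> w (n - d - k) + w (n - d - (k - d))"
        using w0[of "n - d - k"] w0[of "n - k"] by simp
      then have "\<bar>w (n - d - k) - w (n - k)\<bar> * \<xi> (n - d) \<le> (w (n - d - k) + w (n - d - (k - d))) * \<xi> (n - d)"
        by (rule mult_right_mono) (rule \<xi>0)
      then show "t d n \<le> h d * (w (n - d - k) * \<xi> (n - d) + w (n - d - (k - d)) * \<xi> (n - d))"
        unfolding t_def distrib_right[symmetric] by (rule mult_left_mono) (rule h)
      show "0 \<le> t d n" using h \<xi>0 by (simp add: t_def)
    qed
    also have "\<dots> = h d * L2_set (\<lambda>n. w (n - d - k) * \<xi> (n - d) + w (n - d - (k - d)) * \<xi> (n - d)) S"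
      using h by (simp only: L2_set_right_distrib)
    also have "\<dots> \<le> h d * (L2_set (\<lambda>n. w (n - d - k) * \<xi> (n - d)) S + L2_set (\<lambda>n. w (n - d - (k - d)) * \<xi> (n - d)) S)"
      using h by (intro mult_left_mono L2_set_triangle_ineq)
    also have "\<dots> \<le> h d * (u k + u (k - d))"
      using h by (intro mult_left_mono add_mono shift)
    finally show ?thesis .
  qed
  have "L2_set (\<lambda>n. norm (r n)) S \<le> L2_set (\<lambda>n. \<Sum>d\<in>T. t d n) S"
    by (intro L2_set_mono norm_r) auto
  also have "\<dots> \<le> (\<Sum>d\<in>T. L2_set (t d) S)" by (rule L2_set_sum_le)
  also have "T = {d\<in>T. \<bar>d\<bar> \<le> D} \<union> {d\<in>T. \<bar>d\<bar> > D}" by auto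
  also have "(\<Sum>d\<in>{d\<in>T. \<bar>d\<bar> \<le> D} \<union> {d\<in>T. \<bar>d\<bar> > D}. L2_set (t d) S)
      = (\<Sum>d\<in>{d\<in>T. \<bar>d\<bar> \<le> D}. L2_set (t d) S) + (\<Sum>d\<in>{d\<in>T. \<bar>d\<bar> > D}. L2_set (t d) S)"
    using finT by (intro sum.union_disjoint) auto
  also have "\<dots> \<le> (\<Sum>d\<in>{d\<in>T. \<bar>d\<bar> \<le> D}. h d * ((exp (e * D) - 1) * u k)) + ?far"
    by (intro add_mono sum_mono near far) auto
  also have "(\<Sum>d\<in>{d\<in>T. \<bar>d\<bar> \<le> D}. h d * ((exp (e * D) - 1) * u k)) = ?near"
    by (simp add: sum_distrib_left sum_distrib_right algebra_simps)
  finally have r: "L2_set (\<lambda>n. norm (r n)) S \<le> ?near + ?far" .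
  have nrm_y: "norm (y n) = w (n - k) * norm (x n)" for n by (simp add: y_def w0)
  have Ay: "(\<Sum>m\<in>S. a (n - m) (y m)) = w (n - k) *\<^sub>R b n + r n" for n
    by (simp add: y_def b_def r_def lin.scaleR scaleR_sum_right algebra_simps flip: sum.distrib)
  have "\<delta> * (u k)\<^sup>2 = \<delta> * (\<Sum>n\<in>S. (norm (y n))\<^sup>2)"
    by (simp add: u_def L2_set_def nrm_y sum_nonneg)
  also have "\<dots> \<le> (\<Sum>n\<in>S. inner (y n) (w (n - k) *\<^sub>R b n + r n))"
    using coercive[of y] by (simp add: Ay)
  also have "\<dots> \<le> (\<Sum>n\<in>S. \<bar>w (n - k) * norm (x n)\<bar> * \<bar>w (n - k) * norm (b n) + norm (r n)\<bar>)"
  proof (rule sum_mono)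
    fix n
    have "inner (y n) (w (n - k) *\<^sub>R b n + r n) \<le> norm (y n) * norm (w (n - k) *\<^sub>R b n + r n)"
      by (rule norm_cauchy_schwarz)
    also have "\<dots> \<le> norm (y n) * (norm (w (n - k) *\<^sub>R b n) + norm (r n))"
      by (intro mult_left_mono norm_triangle_ineq) auto
    also have "\<dots> = \<bar>w (n - k) * norm (x n)\<bar> * \<bar>w (n - k) * norm (b n) + norm (r n)\<bar>"
      by (simp add: nrm_y w0)
    finally show "inner (y n) (w (n - k) *\<^sub>R b n + r n) \<le>
      \<bar>w (n - k) * norm (x n)\<bar> * \<bar>w (n - k) * norm (b n) + norm (r n)\<bar>" .
  qed
  also have "\<dots> \<le> u k * L2_set (\<lambda>n. w (n - k) * norm (b n) + norm (r n)) S"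
    unfolding u_def by (rule L2_set_mult_ineq)
  also have "\<dots> \<le> u k * (L2_set (\<lambda>n. w (n - k) * norm (b n)) S + L2_set (\<lambda>n. norm (r n)) S)"
    by (intro mult_left_mono L2_set_triangle_ineq u0)
  also have "\<dots> \<le> u k * (?\<beta> + (?near + ?far))"
    using r by (intro mult_left_mono add_mono u0) (auto simp: b_def)
  finally have *: "u k * (\<delta> * u k) \<le> u k * (?\<beta> + (?near + ?far))"
    by (simp add: power2_eq_square mult_ac)
  \<comment> \<open>Cauchy-Schwarz left a factor \<open>u k\<close> on both sides. If it vanishes,
    the claim reduces to nonnegativity of the three terms on the right.\<close>
  show ?thesis
  proof (cases "u k = 0")
    case True
    then show ?thesis using near0 far0 by simp
  next
    case False
    with u0[of k] have "u k > 0" by simp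
    with * show ?thesis by simp
  qed
qed

section \<open>Uniform l1 bounds for finite sections\<close>

lemma summable_on_nonneg_tail:
  fixes h :: "'a \<Rightarrow> real"
  assumes "\<And>n. 0 \<le> h n" "h summable_on UNIV" "\<epsilon> > 0"
  obtains F where "finite F" "\<And>T. finite T \<Longrightarrow> F \<inter> T = {} \<Longrightarrow> (\<Sum>n\<in>T. h n) \<le> \<epsilon>"
proof -
  obtain F where F: "finite F" "\<bar>(\<Sum>n\<in>F. h n) - (\<Sum>\<^sub>\<infinity>n. h n)\<bar> \<le> \<epsilon>"
    using infsum_finite_approximation[OF assms(2,3)] by (auto simp: dist_real_def)
  show ?thesis
  proof (rule that[OF F(1)])
    fix T assume T: "finite T" "F \<inter> T = {}"
    then have "(\<Sum>n\<in>F. h n) + (\<Sum>n\<in>T. h n) = (\<Sum>n\<in>F \<union> T. h n)"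
      using F by (simp add: sum.union_disjoint)
    also have "\<dots> \<le> (\<Sum>\<^sub>\<infinity>n. h n)"
      using F T assms by (intro finite_sum_le_infsum) auto
    finally show "(\<Sum>n\<in>T. h n) \<le> \<epsilon>" using F(2) by linarith
  qed
qed

text \<open>\<open>\<Sum>\<^sub>k u k\<close> is comparable to the \<open>\<ell>\<^sup>1\<close> norm of \<open>x\<close>, so summing the previous estimate turns \<open>\<ell>\<^sup>2\<close> coercivity
  into an \<open>\<ell>\<^sup>1\<close> bound. The point is that \<open>C\<close> does not depend on \<open>S\<close>.\<close>

lemma finite_section_estimate:
  fixes a :: "int \<Rightarrow> 'v::real_inner \<Rightarrow> 'v" and h :: "int \<Rightarrow> real"
  assumes h: "\<And>n. 0 \<le> h n" and sum: "h summable_on UNIV" and lin: "\<And>n. linear (a n)"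
    and bound: "\<And>n v. norm (a n v) \<le> h n * norm v" and \<delta>: "\<delta> > 0"
    and coercive: "\<And>S y. finite S \<Longrightarrow>
      \<delta> * (\<Sum>n\<in>S. (norm (y n))\<^sup>2) \<le> (\<Sum>n\<in>S. inner (y n) (\<Sum>m\<in>S. a (n - m) (y m)))"
  obtains C where "\<And>S x. finite S \<Longrightarrow>
    (\<Sum>n\<in>S. norm (x n)) \<le> C * (\<Sum>n\<in>S. norm (\<Sum>m\<in>S. a (n - m) (x m)))"
proof -
  define H where "H = (\<Sum>\<^sub>\<infinity>n. h n)"
  have H0: "0 \<le> H" using h by (auto simp: H_def intro: infsum_nonneg)
  have H: "(\<Sum>n\<in>T. h n) \<le> H" if "finite T" for T
    unfolding H_def using h that by (intro finite_sum_le_infsum sum) auto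
  obtain F where F: "finite F" "\<And>T. finite T \<Longrightarrow> F \<inter> T = {} \<Longrightarrow> (\<Sum>n\<in>T. h n) \<le> \<delta> / 8"
    using summable_on_nonneg_tail[OF h sum, of "\<delta> / 8"] \<delta> by auto
  \<comment> \<open>A sum instead of a maximum, which also covers an empty \<open>F\<close>.\<close>
  define D where "D = (\<Sum>n\<in>F. \<bar>n\<bar>)"
  have D0: "0 \<le> D" by (simp add: D_def sum_nonneg)
  have D: "\<bar>n\<bar> \<le> D" if "n \<in> F" for n
    unfolding D_def using that F(1) by (intro member_le_sum) auto
  have tail: "(\<Sum>n\<in>T. h n) \<le> \<delta> / 8" if T: "finite T" "\<And>n. n \<in> T \<Longrightarrow> \<bar>n\<bar> > D" for T
    using D T by (intro F(2)) fastforce+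
  \<comment> \<open>Chosen to make \<open>exp (e * D) - 1\<close> at most
    \<open>\<delta> / (4 * (H + 1))\<close>, so that all near diagonals together cost at most
    \<open>\<delta> / 4\<close>. The added ones keep both denominators positive.\<close>
  define e where "e = ln (1 + \<delta> / (4 * (H + 1))) / (D + 1)"
  have ln0: "ln (1 + \<delta> / (4 * (H + 1))) > 0" using \<delta> H0 by (intro ln_gt_zero) simp
  have e: "e > 0" using ln0 D0 by (simp add: e_def)
  have "e * D \<le> e * (D + 1)" using e by simp
  also have "\<dots> = ln (1 + \<delta> / (4 * (H + 1)))" using D0 by (simp add: e_def field_simps)
  finally have "exp (e * D) \<le> 1 + \<delta> / (4 * (H + 1))"
    using \<delta> H0 by (subst ln_ge_iff[symmetric]) (auto intro: add_pos_nonneg)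
  then have "(exp (e * D) - 1) * H \<le> \<delta> / (4 * (H + 1)) * H"
    using H0 by (intro mult_right_mono) auto
  also have "\<dots> \<le> \<delta> / 4" using \<delta> H0 by (simp add: field_simps)
  finally have small: "(exp (e * D) - 1) * H \<le> \<delta> / 4" .
  have eD: "0 \<le> exp (e * D) - 1" using e D0 by simp
  define w where "w = (\<lambda>n::int. exp (- e * \<bar>of_int n\<bar>))"
  have w0: "0 \<le> w n" for n by (simp add: w_def)
  have wsum: "w summable_on UNIV" unfolding w_def using e by (rule summable_on_exp_abs_int)
  define W where "W = (\<Sum>\<^sub>\<infinity>n. w n)"
  have W_has: "((\<lambda>k. w (n - k)) has_sum W) UNIV" for n
    using has_sum_infsum[OF wsum] unfolding W_def
    by (subst has_sum_reindex_bij_witness[of _ "\<lambda>k. n - k" "\<lambda>k. n - k" _ w]) auto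
  show ?thesis
  proof (rule that)
    fix S :: "int set" and x :: "int \<Rightarrow> 'v"
    assume fin: "finite S"
    define b where "b n = (\<Sum>m\<in>S. a (n - m) (x m))" for n
    define u where "u k = L2_set (\<lambda>n. w (n - k) * norm (x n)) S" for k
    define \<beta> where "\<beta> k = L2_set (\<lambda>n. w (n - k) * norm (b n)) S" for k
    define T where "T = (\<lambda>(n, m). n - m) ` (S \<times> S)"
    have finT: "finite T" using fin by (auto simp: T_def)
    have L2_sum: "((\<lambda>k. \<Sum>n\<in>S. w (n - k) * norm (z n)) has_sum W * (\<Sum>n\<in>S. norm (z n))) UNIV" for z :: "int \<Rightarrow> 'v"
      unfolding sum_distrib_left by (intro has_sum_sum has_sum_cmult_left W_has)
    have L2_le: "L2_set (\<lambda>n. w (n - k) * norm (z n)) S \<le> (\<Sum>n\<in>S. w (n - k) * norm (z n))" for z :: "int \<Rightarrow> 'v" and k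
      using w0 by (intro L2_set_le_sum) auto
    have usum: "u summable_on UNIV"
      by (rule summable_on_comparison_test[OF has_sum_imp_summable[OF L2_sum[of x]]]) (auto simp: u_def L2_le)
    have \<beta>sum: "\<beta> summable_on UNIV"
      by (rule summable_on_comparison_test[OF has_sum_imp_summable[OF L2_sum[of b]]]) (auto simp: \<beta>_def L2_le)
    define U where "U = (\<Sum>\<^sub>\<infinity>k. u k)"
    have u0: "0 \<le> u k" for k by (simp add: u_def)
    have U0: "0 \<le> U" unfolding U_def by (rule infsum_nonneg) (rule u0)
    have U_has: "(u has_sum U) UNIV" unfolding U_def using usum by (rule has_sum_infsum)
    have U_shift: "((\<lambda>k. u (k - d)) has_sum U) UNIV" for d
      using U_has by (subst has_sum_reindex_bij_witness[of _ "\<lambda>k. k + d" "\<lambda>k. k - d" _ u]) auto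
    have B: "(\<Sum>\<^sub>\<infinity>k. \<beta> k) \<le> W * (\<Sum>n\<in>S. norm (b n))"
      by (rule has_sum_mono[OF has_sum_infsum[OF \<beta>sum] L2_sum]) (auto simp: \<beta>_def L2_le)
    define near where "near = (exp (e * D) - 1) * (\<Sum>d\<in>{d\<in>T. \<bar>d\<bar> \<le> D}. h d)"
    define far where "far = {d\<in>T. \<bar>d\<bar> > D}"
    have est: "\<delta> * u k \<le> \<beta> k + near * u k + (\<Sum>d\<in>far. h d * (u k + u (k - d)))" for k
      unfolding u_def \<beta>_def b_def w_def near_def far_def T_def
      by (rule weighted_section_estimate[OF fin h lin bound e D0 coercive[OF fin]])
    \<comment> \<open>Summation over \<open>k\<close> turns both \<open>u k\<close> and
      \<open>u (k - d)\<close> into the same total \<open>U\<close>, so a far diagonal costs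
      \<open>2 * h d * U\<close>.\<close>
    have "\<delta> * U \<le> (\<Sum>\<^sub>\<infinity>k. \<beta> k) + near * U + (\<Sum>d\<in>far. h d * (U + U))"
      by (rule has_sum_mono[OF has_sum_cmult_right[OF U_has] _ est])
         (intro has_sum_add has_sum_infsum \<beta>sum has_sum_cmult_right has_sum_sum U_has U_shift)
    moreover have "near * U \<le> (\<delta> / 4) * U"
    proof (intro mult_right_mono U0)
      have "near \<le> (exp (e * D) - 1) * H"
        unfolding near_def using finT by (intro mult_left_mono H eD) auto
      then show "near \<le> \<delta> / 4" using small by simp
    qed
    moreover have "(\<Sum>d\<in>far. h d * (U + U)) \<le> (\<delta> / 8) * (U + U)"
      unfolding sum_distrib_right[symmetric] using finT U0 by (intro mult_right_mono tail) (auto simp: far_def)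
    \<comment> \<open>The near diagonals use \<open>\<delta> / 4\<close>, the far ones twice
      \<open>\<delta> / 8\<close>; half of \<open>\<delta>\<close> remains on the left.\<close>
    ultimately have UB: "\<delta> * U \<le> 2 * (\<Sum>\<^sub>\<infinity>k. \<beta> k)" by (simp add: algebra_simps)
    \<comment> \<open>Lower comparison with the l1 norm: in \<open>u k\<close> the single term
      \<open>n = k\<close> has weight 1.\<close>
    have "(\<Sum>n\<in>S. norm (x n)) \<le> (\<Sum>k\<in>S. u k)"
    proof (rule sum_mono)
      fix k assume "k \<in> S"
      then have "w (k - k) * norm (x k) \<le> u k"
        unfolding u_def by (rule member_le_L2_set[OF fin])
      then show "norm (x k) \<le> u k" by (simp add: w_def)
    qed
    also have "\<dots> \<le> U" unfolding U_def using u0 by (intro finite_sum_le_infsum usum fin) auto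
    also have "\<dots> \<le> 2 / \<delta> * (\<Sum>\<^sub>\<infinity>k. \<beta> k)" using UB \<delta> by (simp add: field_simps)
    also have "\<dots> \<le> 2 / \<delta> * (W * (\<Sum>n\<in>S. norm (b n)))" using B \<delta> by (intro mult_left_mono) auto
    finally show "(\<Sum>n\<in>S. norm (x n)) \<le> (2 / \<delta> * W) * (\<Sum>n\<in>S. norm (\<Sum>m\<in>S. a (n - m) (x m)))"
      by (simp add: b_def mult.assoc)
  qed
qed

text \<open>Elimination of one unknown at a time: a form that is nonzero at nonzero vectors keeps
  this property on smaller index sets, by zero extension, and never produces a zero pivot. A finite
  index set instead of an index type admits sections of every size.\<close>

lemma finite_system_solvable:
  fixes K :: "'i \<Rightarrow> 'i \<Rightarrow> real"
  assumes "finite S"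
    and "\<And>y. \<exists>a\<in>S. y a \<noteq> 0 \<Longrightarrow> (\<Sum>a\<in>S. y a * (\<Sum>b\<in>S. K a b * y b)) \<noteq> 0"
  shows "\<exists>x. \<forall>a\<in>S. (\<Sum>b\<in>S. K a b * x b) = r a"
  using assms
proof (induction S arbitrary: r rule: finite_induct)
  case (insert k S)
  have sol: "\<exists>x. \<forall>a\<in>S. (\<Sum>b\<in>S. K a b * x b) = r a" for r
  proof (rule insert.IH)
    fix y :: "'i \<Rightarrow> real" assume y: "\<exists>a\<in>S. y a \<noteq> 0"
    let ?y = "y(k := 0)"
    have eq: "(\<Sum>b\<in>S. g b * ?y b) = (\<Sum>b\<in>S. g b * y b)" for g
      using insert.hyps by (intro sum.cong) auto
    have "(\<Sum>a\<in>insert k S. ?y a * (\<Sum>b\<in>insert k S. K a b * ?y b)) \<noteq> 0"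
      using y insert.hyps by (intro insert.prems) auto
    also have "(\<Sum>a\<in>insert k S. ?y a * (\<Sum>b\<in>insert k S. K a b * ?y b)) = (\<Sum>a\<in>S. y a * (\<Sum>b\<in>S. K a b * y b))"
      using insert.hyps by (auto simp: eq[of "K _", simplified] intro!: sum.cong)
    finally show "(\<Sum>a\<in>S. y a * (\<Sum>b\<in>S. K a b * y b)) \<noteq> 0" .
  qed
  obtain y where y: "\<And>a. a \<in> S \<Longrightarrow> (\<Sum>b\<in>S. K a b * y b) = r a" using sol by blast
  obtain w where w: "\<And>a. a \<in> S \<Longrightarrow> (\<Sum>b\<in>S. K a b * w b) = K a k" using sol[of "\<lambda>a. K a k"] by blast
  \<comment> \<open>\<open>q\<close> is the Schur complement of the block \<open>S\<close>. It
    equals the form at \<open>v\<close>, because \<open>K\<close> maps \<open>v\<close> to 0 on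
    \<open>S\<close> and \<open>v k = 1\<close>; hence it cannot vanish.\<close>
  define q where "q = K k k - (\<Sum>b\<in>S. K k b * w b)"
  define v where "v b = (if b = k then 1 else - w b)" for b
  have vS: "(\<Sum>b\<in>S. g b * v b) = - (\<Sum>b\<in>S. g b * w b)" for g
    unfolding sum_negf[symmetric] using insert.hyps by (intro sum.cong) (auto simp: v_def)
  have Kv: "(\<Sum>b\<in>insert k S. K a b * v b) = (if a = k then q else 0)" if "a \<in> insert k S" for a
    using that insert.hyps w[of a] by (auto simp: vS q_def v_def[of k])
  have "(\<Sum>a\<in>insert k S. v a * (\<Sum>b\<in>insert k S. K a b * v b)) \<noteq> 0"
    by (rule insert.prems) (auto simp: v_def)
  also have "(\<Sum>a\<in>insert k S. v a * (\<Sum>b\<in>insert k S. K a b * v b)) = (\<Sum>a\<in>insert k S. if a = k then q else 0)"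
    by (intro sum.cong refl) (simp only: Kv, auto simp: v_def)
  also have "\<dots> = q" using insert.hyps by simp
  finally have q: "q \<noteq> 0" .
  \<comment> \<open>Adding a multiple of \<open>v\<close> leaves the equations in \<open>S\<close>
    intact and changes equation \<open>k\<close> at rate \<open>q\<close>.\<close>
  define t where "t = (r k - (\<Sum>b\<in>S. K k b * y b)) / q"
  have "(\<Sum>b\<in>insert k S. K a b * ((if b = k then 0 else y b) + t * v b)) = r a" if a: "a \<in> insert k S" for a
  proof -
    have "(\<Sum>b\<in>insert k S. K a b * ((if b = k then 0 else y b) + t * v b)) =
      (\<Sum>b\<in>insert k S. K a b * (if b = k then 0 else y b)) + t * (\<Sum>b\<in>insert k S. K a b * v b)"
      by (simp only: distrib_left sum.distrib sum_distrib_left mult.left_commute)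
    also have "(\<Sum>b\<in>insert k S. K a b * (if b = k then 0 else y b)) = (\<Sum>b\<in>S. K a b * y b)"
      using insert.hyps by (auto intro!: sum.cong)
    also have "\<dots> + t * (\<Sum>b\<in>insert k S. K a b * v b) = r a"
      unfolding Kv[OF a] using a insert.hyps y q by (auto simp: t_def)
    finally show ?thesis .
  qed
  then show ?case by (intro exI[of _ "\<lambda>b. (if b = k then 0 else y b) + t * v b"]) blast
qed auto

text \<open>Real coordinates indexed by \<open>S \<times> Basis\<close> turn the section into a
  finite linear system whose quadratic form is positive at nonzero vectors by coercivity.\<close>

lemma finite_section_solvable:
  fixes a :: "int \<Rightarrow> 'v::euclidean_space \<Rightarrow> 'v"
  assumes fin: "finite S" and lin: "\<And>n. linear (a n)" and \<delta>: "\<delta> > 0"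
    and coercive: "\<And>y. \<delta> * (\<Sum>n\<in>S. (norm (y n))\<^sup>2) \<le> (\<Sum>n\<in>S. inner (y n) (\<Sum>m\<in>S. a (n - m) (y m)))"
  shows "\<exists>x. \<forall>n\<in>S. (\<Sum>m\<in>S. a (n - m) (x m)) = r n"
proof -
  interpret lin: linear "a n" for n by (rule lin)
  define vec where "vec y n = (\<Sum>i\<in>Basis. y (n, i) *\<^sub>R i)" for y :: "int \<times> 'v \<Rightarrow> real" and n
  define K where "K = (\<lambda>(n, i) (m, j). inner i (a (n - m) j))"
  have row: "(\<Sum>b\<in>S \<times> Basis. K (n, i) b * y b) = inner i (\<Sum>m\<in>S. a (n - m) (vec y m))" for n i y
    by (simp add: K_def vec_def lin.sum lin.scaleR inner_sum_right sum.cartesian_product mult.commute case_prod_unfold)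
  have "\<exists>x. \<forall>c\<in>S \<times> Basis. (\<Sum>b\<in>S \<times> Basis. K c b * x b) = inner (snd c) (r (fst c))"
  proof (rule finite_system_solvable)
    show "finite (S \<times> (Basis :: 'v set))" using fin by simp
    fix y :: "int \<times> 'v \<Rightarrow> real" assume y: "\<exists>a\<in>S \<times> Basis. y a \<noteq> 0"
    then obtain n i where ni: "n \<in> S" "i \<in> Basis" "y (n, i) \<noteq> 0" by auto
    have "(\<Sum>a\<in>S \<times> Basis. y a * (\<Sum>b\<in>S \<times> Basis. K a b * y b)) =
       (\<Sum>n\<in>S. \<Sum>i\<in>Basis. y (n, i) * inner i (\<Sum>m\<in>S. a (n - m) (vec y m)))"
      unfolding sum.cartesian_product[symmetric] by (auto simp: row sum.cartesian_product case_prod_unfold intro!: sum.cong)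
    also have "\<dots> = (\<Sum>n\<in>S. inner (vec y n) (\<Sum>m\<in>S. a (n - m) (vec y m)))"
      by (simp add: vec_def[of y "_::int"] inner_sum_left)
    also have "\<dots> \<ge> \<delta> * (\<Sum>n\<in>S. (norm (vec y n))\<^sup>2)" by (rule coercive)
    moreover have "\<delta> * (\<Sum>n\<in>S. (norm (vec y n))\<^sup>2) > 0"
    proof -
      have "inner (vec y n) i = y (n, i)" using ni by (simp add: vec_def inner_sum_left_Basis)
      with ni have "vec y n \<noteq> 0" by auto
      then have "(\<Sum>n\<in>S. (norm (vec y n))\<^sup>2) > 0"
        using ni fin by (intro sum_pos2[of _ n]) auto
      with \<delta> show ?thesis by simp
    qed
    ultimately show "(\<Sum>a\<in>S \<times> Basis. y a * (\<Sum>b\<in>S \<times> Basis. K a b * y b)) \<noteq> 0" by linarith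
  qed
  then obtain x where x: "\<And>n i. n \<in> S \<Longrightarrow> i \<in> Basis \<Longrightarrow> inner i (\<Sum>m\<in>S. a (n - m) (vec x m)) = inner i (r n)"
    by (auto simp: row)
  show ?thesis
  proof (rule exI[of _ "vec x"], rule ballI, rule euclidean_eqI)
    fix n and i :: 'v assume "n \<in> S" "i \<in> Basis"
    then show "inner (\<Sum>m\<in>S. a (n - m) (vec x m)) i = inner (r n) i"
      using x[of n i] by (simp add: inner_commute[of _ i])
  qed
qed

text \<open>Tychonoff in place of a diagonal argument. Countability of the index type makes the
  product first countable, so compactness yields convergent subsequences.\<close>

lemma bounded_pointwise_convergent_subseq:
  fixes X :: "nat \<Rightarrow> 'i::countable \<Rightarrow> 'v::euclidean_space"
  assumes "\<And>N n. norm (X N n) \<le> C"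
  obtains l r where "strict_mono (r :: nat \<Rightarrow> nat)" "\<And>n. (\<lambda>N. X (r N) n) \<longlonglongrightarrow> l n"
proof -
  have "compactin (product_topology (\<lambda>i::'i. euclidean) UNIV) (PiE UNIV (\<lambda>_. cball (0::'v) C))"
    by (subst compactin_PiE) auto
  then have "compact (PiE UNIV (\<lambda>_::'i. cball (0::'v) C))"
    by (simp add: euclidean_product_topology)
  then have "seq_compact (PiE UNIV (\<lambda>_::'i. cball (0::'v) C))"
    by (rule compact_imp_seq_compact)
  moreover have "\<forall>N. X N \<in> PiE UNIV (\<lambda>_. cball 0 C)" using assms by auto
  ultimately obtain l r where lr: "strict_mono (r :: nat \<Rightarrow> nat)" "(X \<circ> r) \<longlonglongrightarrow> l"
    by (meson seq_compactE)
  show ?thesis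
  proof (rule that[OF lr(1)])
    fix n
    have "continuous_on UNIV (\<lambda>f :: 'i \<Rightarrow> 'v. f n)" by (rule continuous_on_product_coordinates)
    from continuous_on_tendsto_compose[OF this lr(2)]
    show "(\<lambda>N. X (r N) n) \<longlonglongrightarrow> l n" by (simp add: o_def)
  qed
qed

text \<open>The solutions on \<open>{0..<N}\<close> are bounded in \<open>\<ell>\<^sup>1\<close> uniformly in \<open>N\<close>; a pointwise limit of a subsequence solves
  the equation on the half-line.\<close>

lemma coercive_half_line_solution:
  fixes a :: "int \<Rightarrow> 'v::euclidean_space \<Rightarrow> 'v" and h :: "int \<Rightarrow> real" and v :: 'v
  assumes h: "\<And>n. 0 \<le> h n" and sum: "h summable_on UNIV" and lin: "\<And>n. linear (a n)"
    and bound: "\<And>n v. norm (a n v) \<le> h n * norm v" and \<delta>: "\<delta> > 0"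
    and coercive: "\<And>S y. finite S \<Longrightarrow>
      \<delta> * (\<Sum>n\<in>S. (norm (y n))\<^sup>2) \<le> (\<Sum>n\<in>S. inner (y n) (\<Sum>m\<in>S. a (n - m) (y m)))"
  obtains x where "(\<lambda>n. norm (x n)) summable_on UNIV" "\<And>n. n < 0 \<Longrightarrow> x n = 0"
    "\<And>n. 0 \<le> n \<Longrightarrow> ((\<lambda>m. a (n - m) (x m)) has_sum (if n = 0 then v else 0)) UNIV"
proof -
  interpret lin: linear "a n" for n by (rule lin)
  define e where "e n = (if n = 0 then v else 0)" for n :: int
  obtain C0 where C0: "\<And>S x. finite S \<Longrightarrow>
    (\<Sum>n\<in>S. norm (x n)) \<le> C0 * (\<Sum>n\<in>S. norm (\<Sum>m\<in>S. a (n - m) (x m)))"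
    using finite_section_estimate[OF h sum lin bound \<delta> coercive] by blast
  define I where "I N = {0..<int N}" for N
  have finI: "finite (I N)" for N by (simp add: I_def)
  have "\<exists>x. \<forall>n\<in>I N. (\<Sum>m\<in>I N. a (n - m) (x m)) = e n" for N
    by (rule finite_section_solvable[OF finI lin \<delta> coercive[OF finI]])
  then obtain X0 where X0: "\<And>N n. n \<in> I N \<Longrightarrow> (\<Sum>m\<in>I N. a (n - m) (X0 N m)) = e n" by metis
  define X where "X N n = (if n \<in> I N then X0 N n else 0)" for N n
  have X: "(\<Sum>m\<in>I N. a (n - m) (X N m)) = e n" if "n \<in> I N" for N n
    using X0[OF that] by (simp add: X_def)
  define C where "C = \<bar>C0\<bar> * norm v"
  have XC: "(\<Sum>n\<in>G. norm (X N n)) \<le> C" if G: "finite G" for N G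
  proof -
    have "(\<Sum>n\<in>G. norm (X N n)) = (\<Sum>n\<in>G \<inter> I N. norm (X N n))"
      using G by (intro sum.mono_neutral_right) (auto simp: X_def)
    also have "\<dots> \<le> (\<Sum>n\<in>I N. norm (X N n))" by (intro sum_mono2 finI) auto
    also have "\<dots> \<le> C0 * (\<Sum>n\<in>I N. norm (\<Sum>m\<in>I N. a (n - m) (X N m)))" by (rule C0[OF finI])
    also have "(\<Sum>n\<in>I N. norm (\<Sum>m\<in>I N. a (n - m) (X N m))) = (\<Sum>n\<in>I N. norm (e n))"
      by (intro sum.cong) (auto simp: X)
    \<comment> \<open>The section estimate gives no sign for \<open>C0\<close>.\<close>
    also have "C0 * \<dots> \<le> \<bar>C0\<bar> * (\<Sum>n\<in>I N. norm (e n))"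
      by (intro mult_right_mono sum_nonneg) auto
    also have "\<dots> \<le> \<bar>C0\<bar> * norm v"
    proof (intro mult_left_mono)
      have "(\<Sum>n\<in>I N. norm (e n)) = (\<Sum>n\<in>I N. if n = 0 then norm v else 0)"
        by (intro sum.cong) (auto simp: e_def)
      also have "\<dots> \<le> norm v" using finI by (simp add: sum.delta)
      finally show "(\<Sum>n\<in>I N. norm (e n)) \<le> norm v" .
    qed auto
    finally show ?thesis by (simp add: C_def)
  qed
  have C0': "0 \<le> C" by (simp add: C_def)
  have "norm (X N n) \<le> C" for N n using XC[of "{n}" N] by simp
  then obtain x r where r: "strict_mono (r :: nat \<Rightarrow> nat)" and x: "\<And>n. (\<lambda>N. X (r N) n) \<longlonglongrightarrow> x n"
    using bounded_pointwise_convergent_subseq by blast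
  show ?thesis
  proof (rule that)
    show "(\<lambda>n. norm (x n)) summable_on UNIV"
    proof (rule nonneg_bdd_above_summable_on)
      show "bdd_above (sum (\<lambda>n. norm (x n)) ` {F. F \<subseteq> UNIV \<and> finite F})"
      proof (rule bdd_aboveI2)
        fix G :: "int set" assume "G \<in> {F. F \<subseteq> UNIV \<and> finite F}"
        then have "finite G" by auto
        then show "(\<Sum>n\<in>G. norm (x n)) \<le> C"
          by (intro LIMSEQ_le_const2[OF tendsto_sum[OF tendsto_norm[OF x]]]) (auto intro: XC)
      qed
    qed auto
    show "x n = 0" if "n < 0" for n
    proof -
      have "X N n = 0" for N using that by (simp add: X_def I_def)
      then show ?thesis using LIMSEQ_unique[OF x[of n]] by simp
    qed
    fix n :: int assume n: "0 \<le> n"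
    have "((\<lambda>m. a (n - m) (x m)) has_sum e n) UNIV"
      unfolding has_sum_def
    proof (rule tendstoI)
      fix \<epsilon> :: real assume \<epsilon>: "\<epsilon> > 0"
      define \<eta> where "\<eta> = \<epsilon> / (2 * (C + 1))"
      have \<eta>: "\<eta> > 0" using \<epsilon> C0' by (simp add: \<eta>_def)
      have "C * \<epsilon> < 2 * (C + 1) * \<epsilon>" using \<epsilon> C0' by (intro mult_strict_right_mono) auto
      then have \<eta>C: "\<eta> * C < \<epsilon>" using C0' by (simp add: \<eta>_def field_simps)
      obtain F where F: "finite F" "\<And>T. finite T \<Longrightarrow> F \<inter> T = {} \<Longrightarrow> (\<Sum>n\<in>T. h n) \<le> \<eta>"
        using summable_on_nonneg_tail[OF h sum \<eta>] by blast
      \<comment> \<open>Smallness of the tail enters only pointwise: coefficients outside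
        \<open>F\<close> are at most \<open>\<eta>\<close>, and the l1 bound \<open>C\<close> on the
        section solutions then controls the remaining sum uniformly in \<open>N\<close>.\<close>
      have small: "h k \<le> \<eta>" if "k \<notin> F" for k using F(2)[of "{k}"] that by simp
      define G0 where "G0 = (\<lambda>k. n - k) ` F"
      have small': "h (n - m) \<le> \<eta>" if "m \<notin> G0" for m
        using that by (intro small) (auto simp: G0_def image_iff)
      have "dist (\<Sum>m\<in>G. a (n - m) (x m)) (e n) < \<epsilon>" if G: "finite G" "G0 \<subseteq> G" for G
      proof -
        have cont: "(\<lambda>N. a k (X (r N) m)) \<longlonglongrightarrow> a k (x m)" for k m
          using linear_continuous_at[OF linear_conv_bounded_linear[THEN iffD1, OF lin]] x
          by (rule isCont_tendsto_compose)
        have "(\<lambda>N. norm ((\<Sum>m\<in>G. a (n - m) (X (r N) m)) - e n)) \<longlonglongrightarrow> norm ((\<Sum>m\<in>G. a (n - m) (x m)) - e n)"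
          by (intro tendsto_intros cont)
        moreover have "norm ((\<Sum>m\<in>G. a (n - m) (X (r N) m)) - e n) \<le> \<eta> * C" if N: "N \<ge> nat n + 1" for N
        proof -
          \<comment> \<open>The bound \<open>nat n + 1 \<le> N \<le> r N\<close> puts
            \<open>n\<close> inside the section, where the equation holds.\<close>
          have "n \<in> I (r N)" using n N seq_suble[OF r, of N] by (auto simp: I_def)
          then have "e n = (\<Sum>m\<in>I (r N). a (n - m) (X (r N) m))" by (simp add: X)
          also have "\<dots> = (\<Sum>m\<in>I (r N) \<union> G. a (n - m) (X (r N) m))"
            using finI G by (intro sum.mono_neutral_left) (auto simp: X_def lin.zero)
          also have "I (r N) \<union> G = G \<union> (I (r N) - G)" by auto
          also have "(\<Sum>m\<in>G \<union> (I (r N) - G). a (n - m) (X (r N) m)) =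
            (\<Sum>m\<in>G. a (n - m) (X (r N) m)) + (\<Sum>m\<in>I (r N) - G. a (n - m) (X (r N) m))"
            using finI G by (intro sum.union_disjoint) auto
          finally have "norm ((\<Sum>m\<in>G. a (n - m) (X (r N) m)) - e n) = norm (\<Sum>m\<in>I (r N) - G. a (n - m) (X (r N) m))"
            by simp
          also have "\<dots> \<le> (\<Sum>m\<in>I (r N) - G. \<eta> * norm (X (r N) m))"
          proof (rule sum_norm_le)
            fix m assume "m \<in> I (r N) - G"
            then have "h (n - m) \<le> \<eta>" using G by (intro small') auto
            then show "norm (a (n - m) (X (r N) m)) \<le> \<eta> * norm (X (r N) m)"
              using bound[of "n - m" "X (r N) m"] by (meson mult_right_mono norm_ge_zero order_trans)
          qed
          also have "\<dots> \<le> \<eta> * C"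
            unfolding sum_distrib_left[symmetric] using \<eta> finI by (intro mult_left_mono XC) auto
          finally show ?thesis .
        qed
        ultimately have "norm ((\<Sum>m\<in>G. a (n - m) (x m)) - e n) \<le> \<eta> * C"
          by (intro LIMSEQ_le_const2) auto
        with \<eta>C show ?thesis by (simp add: dist_norm)
      qed
      then show "\<forall>\<^sub>F G in finite_subsets_at_top UNIV. dist (\<Sum>m\<in>G. a (n - m) (x m)) (e n) < \<epsilon>"
        using F(1) unfolding eventually_finite_subsets_at_top
        by (intro exI[of _ G0]) (auto simp: G0_def)
    qed
    then show "((\<lambda>m. a (n - m) (x m)) has_sum (if n = 0 then v else 0)) UNIV"
      by (simp add: e_def)
  qed
qed

section \<open>Complex matrices\<close>

definition cadjoint :: "complex^'n^'m \<Rightarrow> complex^'m^'n"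
  where "cadjoint M = transpose (map_matrix cnj M)"

lemma cadjoint_nth [simp]: "cadjoint M $ i $ j = cnj (M $ j $ i)"
  by (simp add: cadjoint_def transpose_def)

lemma cadjoint_mult: "cadjoint (A ** B) = cadjoint B ** cadjoint A"
  by (simp add: vec_eq_iff matrix_matrix_mult_def mult.commute)

lemma cadjoint_cadjoint [simp]: "cadjoint (cadjoint A) = A"
  by (simp add: vec_eq_iff)

lemma cadjoint_zero [simp]: "cadjoint 0 = 0"
  by (simp add: vec_eq_iff)

lemma cadjoint_mat_1 [simp]: "cadjoint (mat 1) = mat 1"
  by (simp add: vec_eq_iff mat_def)

text \<open>Conjugate-linear in the first argument, as in the form behind
  \<open>complex_pos_def\<close>. The real \<open>inner\<close> is only its real part; polarization
  and Gram-Schmidt need the complex value.\<close>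

definition cdot :: "complex^'n \<Rightarrow> complex^'n \<Rightarrow> complex"
  where "cdot v w = (\<Sum>i\<in>UNIV. cnj (v $ i) * w $ i)"

lemma inner_eq_Re_cdot: "inner v w = Re (cdot v w)"
  by (simp add: cdot_def inner_vec_def inner_complex_def)

lemma cdot_linear:
  "cdot v (w + w') = cdot v w + cdot v w'" "cdot (v + v') w = cdot v w + cdot v' w"
  "cdot v (w - w') = cdot v w - cdot v w'"
  "cdot v (c *s w) = c * cdot v w" "cdot (c *s v) w = cnj c * cdot v w"
  "cdot v (\<Sum>k\<in>I. x k) = (\<Sum>k\<in>I. cdot v (x k))"
proof -
  show "cdot v (\<Sum>k\<in>I. x k) = (\<Sum>k\<in>I. cdot v (x k))"
    unfolding cdot_def sum_component sum_distrib_left by (rule sum.swap)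
qed (simp_all add: cdot_def algebra_simps sum.distrib sum_distrib_left sum_subtractf)

lemma cdot_matrix_adjoint: "cdot v (A *v w) = cdot (cadjoint A *v v) w"
proof -
  have "cdot v (A *v w) = (\<Sum>i\<in>UNIV. \<Sum>j\<in>UNIV. cnj (v $ i) * (A $ i $ j * w $ j))"
    by (simp add: cdot_def matrix_vector_mult_def sum_distrib_left)
  also have "\<dots> = (\<Sum>j\<in>UNIV. \<Sum>i\<in>UNIV. cnj (v $ i) * (A $ i $ j * w $ j))" by (rule sum.swap)
  also have "\<dots> = cdot (cadjoint A *v v) w"
    by (simp add: cdot_def matrix_vector_mult_def sum_distrib_left sum_distrib_right mult_ac)
  finally show ?thesis .
qed

lemma cdot_axis: "cdot (axis i 1) w = w $ i" "cdot v (axis i 1) = cnj (v $ i)"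
  by (simp_all add: cdot_def axis_def if_distrib[of cnj] if_distrib[of "\<lambda>x. x * _"] if_distrib[of "\<lambda>x. _ * x"] cong: if_cong)

lemma complex_pos_def_cdot:
  "complex_pos_def A \<longleftrightarrow> (\<forall>x. x \<noteq> 0 \<longrightarrow> cdot x (A *v x) \<in> \<real> \<and> 0 < Re (cdot x (A *v x)))"
  by (simp add: complex_pos_def_def cdot_def)

text \<open>Polarization: reality of the form at \<open>v + w\<close> settles the imaginary parts,
  at \<open>v + \<i> *s w\<close> the real parts.\<close>

lemma complex_pos_def_sesquilinear_hermitian:
  assumes "complex_pos_def A"
  shows "cdot v (A *v w) = cnj (cdot w (A *v v))"
proof -
  have real: "Im (cdot x (A *v x)) = 0" for x
    using assms by (cases "x = 0") (auto simp: complex_pos_def_cdot complex_is_Real_iff cdot_def)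
  have "Im (cdot v (A *v w)) + Im (cdot w (A *v v)) = 0"
    using real[of "v + w"] real[of v] real[of w] by (simp add: matrix_vector_right_distrib cdot_linear)
  moreover have "Re (cdot v (A *v w)) = Re (cdot w (A *v v))"
    using real[of "v + \<i> *s w"] real[of v] real[of w]
    by (simp add: matrix_vector_right_distrib cdot_linear vector_scalar_commute)
  ultimately show ?thesis by (simp add: complex_eq_iff)
qed

lemma complex_pos_def_hermitian:
  assumes "complex_pos_def A"
  shows "cadjoint A = A"
proof -
  have "cnj (A $ j $ i) = A $ i $ j" for i j
    using complex_pos_def_sesquilinear_hermitian[OF assms, of "axis i 1" "axis j 1"]
    unfolding cdot_axis by (simp add: matrix_vector_mult_def axis_def if_distrib[of "\<lambda>x. _ * x"] cong: if_cong)
  then show ?thesis by (simp add: vec_eq_iff)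
qed

text \<open>Gram-Schmidt on the standard basis for the form of \<open>A\<close>, with the resulting
  vectors as columns of \<open>U\<close>. Such a congruence normalizes a constant positive matrix
  without forming its square root.\<close>

lemma complex_pos_def_gram_schmidt:
  fixes A :: "complex^'n^'n"
  assumes pd: "complex_pos_def A"
  obtains U :: "complex^'n^'n" where "cadjoint U ** A ** U = mat 1"
proof -
  define B where "B v w = cdot v (A *v w)" for v w
  have herm: "B v w = cnj (B w v)" for v w
    unfolding B_def by (rule complex_pos_def_sesquilinear_hermitian[OF pd])
  have B_lin: "B v (w - w') = B v w - B v w'" "B v (c *s w) = c * B v w" "B (c *s v) w = cnj c * B v w"
    "B v (\<Sum>k\<in>I. x k) = (\<Sum>k\<in>I. B v (x k))" for v w w' c x and I :: "'n set"
    by (simp_all add: B_def cdot_linear matrix_vector_mult_diff_distrib vector_scalar_commute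
        linear_sum[OF matrix_vector_mul_linear])
  \<comment> \<open>The support clause makes coordinate \<open>k\<close> of the next vector
    \<open>v\<close> equal to 1, which shows \<open>v \<noteq> 0\<close> without any argument about
    linear independence.\<close>
  have "\<exists>u. (\<forall>i\<in>S. \<forall>j\<in>S. B (u i) (u j) = (if i = j then 1 else 0)) \<and> (\<forall>i\<in>S. \<forall>k. k \<notin> S \<longrightarrow> u i $ k = 0)"
    if "finite S" for S :: "'n set"
    using that
  proof (induction S rule: finite_induct)
    case (insert k S)
    then obtain u where u: "\<And>i j. i \<in> S \<Longrightarrow> j \<in> S \<Longrightarrow> B (u i) (u j) = (if i = j then 1 else 0)"
      and supp: "\<And>i l. i \<in> S \<Longrightarrow> l \<notin> S \<Longrightarrow> u i $ l = 0" by blast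
    define v where "v = axis k 1 - (\<Sum>i\<in>S. B (u i) (axis k 1) *s u i)"
    have orth: "B (u j) v = 0" if "j \<in> S" for j
    proof -
      have "B (u j) v = B (u j) (axis k 1) - (\<Sum>i\<in>S. B (u i) (axis k 1) * (if j = i then 1 else 0))"
        using that by (simp add: v_def B_lin u)
      also have "\<dots> = 0" using insert.hyps that by (simp add: if_distrib cong: if_cong)
      finally show ?thesis .
    qed
    have vsupp: "v $ l = (if l = k then 1 else 0)" if "l \<notin> S" for l
      using that supp by (simp add: v_def axis_def)
    then have "v $ k = 1" using insert.hyps by simp
    then have "v \<noteq> 0" by auto
    then have Bvv: "B v v \<in> \<real>" "0 < Re (B v v)" using pd by (auto simp: B_def complex_pos_def_cdot)
    define s where "s = sqrt (Re (B v v))"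
    have s: "s > 0" "B v v = of_real s * of_real s"
      using Bvv by (auto simp: s_def complex_is_Real_iff complex_eq_iff)
    let ?u = "u(k := of_real (1 / s) *s v)"
    have "B (?u i) (?u j) = (if i = j then 1 else 0)" if "i \<in> insert k S" "j \<in> insert k S" for i j
      using that insert.hyps u orth s herm[of v "u j"] by (auto simp: B_lin)
    moreover have "?u i $ l = 0" if "i \<in> insert k S" "l \<notin> insert k S" for i l
      using that supp vsupp[of l] by auto
    ultimately show ?case by (intro exI[of _ ?u]) blast
  qed auto
  from this[OF finite_class.finite_UNIV] obtain u :: "'n \<Rightarrow> complex^'n"
    where "\<forall>i\<in>UNIV. \<forall>j\<in>UNIV. B (u i) (u j) = (if i = j then 1 else 0)" by blast
  then have u: "B (u i) (u j) = (if i = j then 1 else 0)" for i j by blast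
  define U where "U = (\<chi> i j. u j $ i)"
  have "(cadjoint U ** (A ** U)) $ i $ j = B (u i) (u j)" for i j
    by (simp add: B_def U_def cdot_def matrix_matrix_mult_def matrix_vector_mult_def)
  then have "cadjoint U ** A ** U = mat 1"
    by (simp add: vec_eq_iff u mat_def flip: matrix_mul_assoc)
  then show ?thesis by (rule that)
qed

section \<open>Matrix-valued Wiener series\<close>

definition wiener_mat :: "(int \<Rightarrow> complex^'m^'n) \<Rightarrow> (complex \<Rightarrow> complex^'m^'n) \<Rightarrow> bool"
  where "wiener_mat c g \<longleftrightarrow> (\<forall>i j. wiener_coeffs (\<lambda>n. c n $ i $ j) (\<lambda>z. g z $ i $ j))"

lemma wiener_matD: "wiener_mat c g \<Longrightarrow> wiener_coeffs (\<lambda>n. c n $ i $ j) (\<lambda>z. g z $ i $ j)"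
  by (simp add: wiener_mat_def)

lemma wiener_mat_abs_summable:
  assumes "wiener_mat c g"
  shows "(\<lambda>n. \<Sum>i\<in>UNIV. \<Sum>j\<in>UNIV. cmod (c n $ i $ j)) summable_on UNIV"
  by (rule has_sum_imp_summable[OF has_sum_sum[OF has_sum_sum[OF has_sum_infsum[OF
          wiener_coeffsD(1)[OF wiener_matD[OF assms]]]]]])

text \<open>The finite sum stands outside the infinite one, so that the product rule follows
  entrywise from the scalar case.\<close>

definition conv_mat :: "(int \<Rightarrow> complex^'l^'n) \<Rightarrow> (int \<Rightarrow> complex^'m^'l) \<Rightarrow> int \<Rightarrow> complex^'m^'n"
  where "conv_mat c d n = (\<chi> i j. \<Sum>k\<in>UNIV. \<Sum>\<^sub>\<infinity>m. c (n - m) $ i $ k * d m $ k $ j)"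

lemma wiener_mat_mult:
  assumes "wiener_mat c g" "wiener_mat d h"
  shows "wiener_mat (conv_mat c d) (\<lambda>z. g z ** h z)"
  unfolding wiener_mat_def conv_mat_def matrix_matrix_mult_def
  by (auto intro!: wiener_coeffs_sum wiener_coeffs_mult wiener_matD assms)

lemma wiener_mat_cadjoint: "wiener_mat c g \<Longrightarrow> wiener_mat (\<lambda>n. cadjoint (c (- n))) (\<lambda>z. cadjoint (g z))"
  by (auto simp: wiener_mat_def intro: wiener_coeffs_cnj)

lemma wiener_mat_reflect: "wiener_mat c g \<Longrightarrow> wiener_mat (\<lambda>n. c (- n)) (\<lambda>z. g (cnj z))"
  by (auto simp: wiener_mat_def intro: wiener_coeffs_reflect)

lemma wiener_mat_mult_const:
  assumes "wiener_mat c g"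
  shows "wiener_mat (\<lambda>n. c n ** U) (\<lambda>z. g z ** U)"
  unfolding wiener_mat_def matrix_matrix_mult_def
  by (auto simp: mult.commute[of _ "U $ _ $ _"] intro!: wiener_coeffs_sum wiener_coeffs_cmult wiener_matD assms)

lemma wiener_mat_unique:
  assumes "wiener_mat c g" "wiener_mat d h" "\<And>z. cmod z = 1 \<Longrightarrow> g z = h z"
  shows "c n = d n"
  using wiener_coeffs_unique[OF wiener_matD[OF assms(1)] wiener_matD[OF assms(2)]] assms(3)
  by (simp add: vec_eq_iff)

text \<open>A positive \<open>n\<close> is not the sum of two nonpositive indices
  \<open>n - m\<close> and \<open>m\<close>, so every term has a vanishing factor.\<close>

lemma conv_mat_zero_of_pos:
  assumes "\<And>n. n > 0 \<Longrightarrow> c n = 0" "\<And>n. n > 0 \<Longrightarrow> d n = 0" "n > 0"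
  shows "conv_mat c d n = 0"
proof -
  have "c (n - m) $ i $ k * d m $ k $ j = 0" for m i j k
  proof (cases "m > 0")
    case True then show ?thesis by (simp add: assms(2))
  next
    case False
    then have "n - m > 0" using assms(3) by simp
    then show ?thesis by (simp add: assms(1))
  qed
  then show ?thesis unfolding conv_mat_def by (simp only: infsum_0_simp sum.neutral_const) (simp add: vec_eq_iff)
qed

lemma wiener_mat_constant:
  assumes "wiener_mat c g" "\<And>n. n \<noteq> 0 \<Longrightarrow> c n = 0" "cmod z = 1"
  shows "g z = c 0"
proof -
  have "g z $ i $ j = c 0 $ i $ j" for i j
  proof -
    have "((\<lambda>n. c n $ i $ j * z powi n) has_sum c 0 $ i $ j) UNIV"
      by (rule has_sum_finite_neutralI[of "{0}"]) (auto simp: assms(2))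
    then show ?thesis
      using wiener_coeffsD(2)[OF wiener_matD[OF assms(1)] assms(3)] has_sum_unique by blast
  qed
  then show ?thesis by (simp add: vec_eq_iff)
qed

section \<open>Spectral factorization over the complex numbers\<close>

text \<open>By continuity the form attains its minimum on the compact product of the unit circle and
  the unit sphere. The minimum is positive, and homogeneity in \<open>v\<close> does the
  rest.\<close>

lemma wiener_mat_uniformly_pos_def:
  fixes f :: "complex \<Rightarrow> complex^'p^'p"
  assumes F: "wiener_mat F f" and pd: "\<And>z. cmod z = 1 \<Longrightarrow> complex_pos_def (f z)"
  obtains \<delta> where "\<delta> > 0" "\<And>z v. cmod z = 1 \<Longrightarrow> \<delta> * (norm v)\<^sup>2 \<le> inner v (f z *v v)"
proof -
  let ?K = "sphere (0::complex) 1 \<times> sphere (0::complex^'p) 1"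
  let ?\<phi> = "\<lambda>(z, v). inner v (f z *v v)"
  have cpt: "compact ?K" by (intro compact_Times compact_sphere)
  have "(1, axis undefined 1) \<in> ?K" by simp
  then have ne: "?K \<noteq> {}" by blast
  have cont: "continuous_on ?K ?\<phi>"
  proof -
    have "continuous_on ?K (\<lambda>x. f (fst x) $ i $ j)" for i j
      by (rule continuous_on_compose2[OF wiener_coeffs_continuous[OF wiener_matD[OF F]]])
         (auto intro: continuous_intros)
    moreover have "continuous_on ?K (\<lambda>x. \<Sum>i\<in>UNIV. inner (snd x $ i) (\<Sum>j\<in>UNIV. \<psi> i j x * snd x $ j))"
      if "\<And>i j. continuous_on ?K (\<psi> i j)" for \<psi> :: "'p \<Rightarrow> 'p \<Rightarrow> complex \<times> (complex^'p) \<Rightarrow> complex"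
      by (intro continuous_intros that)
    ultimately show ?thesis
      by (simp add: case_prod_unfold inner_vec_def matrix_vector_mult_def)
  qed
  obtain x0 where "x0 \<in> ?K" "\<forall>x\<in>?K. ?\<phi> x0 \<le> ?\<phi> x"
    using continuous_attains_inf[OF cpt ne cont] by (elim bexE)
  then have x0: "x0 \<in> ?K" "\<And>x. x \<in> ?K \<Longrightarrow> ?\<phi> x0 \<le> ?\<phi> x" by blast+
  show ?thesis
  proof (rule that)
    have "snd x0 \<noteq> 0" "cmod (fst x0) = 1" using x0(1) by auto
    then show "?\<phi> x0 > 0"
      using pd[of "fst x0"] by (auto simp: inner_eq_Re_cdot complex_pos_def_cdot case_prod_unfold)
    fix z :: complex and v :: "complex^'p"
    assume z: "cmod z = 1"
    show "?\<phi> x0 * (norm v)\<^sup>2 \<le> inner v (f z *v v)"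
    proof (cases "v = 0")
      case False
      define w where "w = v /\<^sub>R norm v"
      have w: "norm w = 1" "v = norm v *\<^sub>R w" using False by (simp_all add: w_def)
      have "?\<phi> x0 * (norm v)\<^sup>2 \<le> inner w (f z *v w) * (norm v)\<^sup>2"
        using x0(2)[of "(z, w)"] z w by (intro mult_right_mono) auto
      also have "inner w (f z *v w) * (norm v)\<^sup>2 = inner (norm v *\<^sub>R w) (f z *v (norm v *\<^sub>R w))"
        by (simp add: linear_scale[OF matrix_vector_mul_linear] power2_eq_square)
      also have "norm v *\<^sub>R w = v" using w by simp
      finally show ?thesis .
    qed simp
  qed
qed

text \<open>The form is the zeroth Fourier coefficient of \<open>Y\<^sup>* f Y\<close>, where \<open>Y(z) = \<Sum>\<^sub>n z\<^sup>n y\<^sub>n\<close>.\<close>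

lemma toeplitz_form_nonneg:
  fixes f :: "complex \<Rightarrow> complex^'p^'p" and y :: "int \<Rightarrow> complex^'p"
  assumes F: "wiener_mat F f" and pos: "\<And>z v. cmod z = 1 \<Longrightarrow> 0 \<le> inner v (f z *v v)"
  shows "0 \<le> (\<Sum>n\<in>S. inner (y n) (\<Sum>m\<in>S. F (n - m) *v y m))"
proof -
  \<comment> \<open>Multiplication by \<open>z powi (m - n)\<close> shifts the index by
    \<open>m - n\<close>, so at \<open>l = 0\<close> the entry is \<open>F (n - m)\<close>, as in
    the Toeplitz form.\<close>
  let ?c = "\<lambda>l. \<Sum>n\<in>S. \<Sum>m\<in>S. \<Sum>i\<in>UNIV. \<Sum>j\<in>UNIV. (cnj (y n $ i) * y m $ j) * F (l - (m - n)) $ i $ j"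
  let ?g = "\<lambda>z. \<Sum>n\<in>S. \<Sum>m\<in>S. \<Sum>i\<in>UNIV. \<Sum>j\<in>UNIV. (cnj (y n $ i) * y m $ j) * (z powi (m - n) * f z $ i $ j)"
  have ser: "wiener_coeffs ?c ?g"
    by (intro wiener_coeffs_sum wiener_coeffs_cmult wiener_coeffs_shift[OF wiener_matD[OF F]])
  have "0 \<le> Re (?g z)" if z: "cmod z = 1" for z
  proof -
    have nz: "z \<noteq> 0" using z by auto
    define Y where "Y = (\<Sum>n\<in>S. z powi n *s y n)"
    have "?g z = (\<Sum>n\<in>S. \<Sum>m\<in>S. cnj (z powi n) * (z powi m * cdot (y n) (f z *v y m)))"
      by (simp add: cdot_def matrix_vector_mult_def sum_distrib_left sum_distrib_right
          power_int_diff nz cnj_powi_circle z power_int_minus field_simps)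
    also have "\<dots> = cdot Y (f z *v Y)"
    proof -
      have left: "cdot (\<Sum>n\<in>S. x n) w = (\<Sum>n\<in>S. cdot (x n) w)" for x :: "int \<Rightarrow> complex^'p" and w
        by (simp add: cdot_def sum_distrib_right sum.swap[of _ S])
      show ?thesis
        unfolding Y_def left
        by (simp add: linear_sum[OF matrix_vector_mul_linear] cdot_linear vector_scalar_commute mult.left_commute)
    qed
    finally show ?thesis using pos[OF z, of Y] by (simp only: inner_eq_Re_cdot)
  qed
  then have "0 \<le> Re (?c 0)" by (rule wiener_coeffs_mean_nonneg[OF ser])
  also have "?c 0 = (\<Sum>n\<in>S. cdot (y n) (\<Sum>m\<in>S. F (n - m) *v y m))"
    by (simp add: cdot_linear(6)) (simp add: cdot_def matrix_vector_mult_def sum_distrib_left mult_ac)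
  finally show ?thesis by (simp add: inner_eq_Re_cdot)
qed

text \<open>Nonnegativity of the form is applied to the symbol \<open>f - \<delta>\<close>; the
  constant symbol \<open>\<delta>\<close> contributes exactly \<open>\<delta>\<close> times the
  squared l2 norm.\<close>

lemma toeplitz_form_coercive:
  fixes f :: "complex \<Rightarrow> complex^'p^'p" and y :: "int \<Rightarrow> complex^'p"
  assumes F: "wiener_mat F f"
    and pos: "\<And>z v. cmod z = 1 \<Longrightarrow> \<delta> * (norm v)\<^sup>2 \<le> inner v (f z *v v)"
    and fin: "finite S"
  shows "\<delta> * (\<Sum>n\<in>S. (norm (y n))\<^sup>2) \<le> (\<Sum>n\<in>S. inner (y n) (\<Sum>m\<in>S. F (n - m) *v y m))"
proof -
  let ?I = "\<lambda>n::int. if n = 0 then mat (of_real \<delta>) else 0 :: complex^'p^'p"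
  have mat: "mat (of_real \<delta>) *v v = \<delta> *\<^sub>R v" for v :: "complex^'p"
    by (simp add: vec_eq_iff matrix_vector_mult_def mat_def if_distrib[of "\<lambda>x. x * _"] scaleR_conv_of_real[symmetric] cong: if_cong)
  have "wiener_coeffs (\<lambda>n. F n $ i $ j + (if n = 0 then - mat (of_real \<delta>) $ i $ j else 0))
      (\<lambda>z. f z $ i $ j + (- mat (of_real \<delta>) $ i $ j) * z powi 0)" for i j
    by (intro wiener_coeffs_add wiener_matD[OF F] wiener_coeffs_monomial)
  then have "wiener_coeffs (\<lambda>n. (F n - ?I n) $ i $ j) (\<lambda>z. (f z - mat (of_real \<delta>)) $ i $ j)" for i j
    by (rule wiener_coeffs_cong) auto
  then have M: "wiener_mat (\<lambda>n. F n - ?I n) (\<lambda>z. f z - mat (of_real \<delta>))"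
    by (simp add: wiener_mat_def)
  have "0 \<le> (\<Sum>n\<in>S. inner (y n) (\<Sum>m\<in>S. (F (n - m) - ?I (n - m)) *v y m))"
    by (rule toeplitz_form_nonneg[OF M])
      (use pos in \<open>auto simp: matrix_vector_mult_diff_rdistrib mat inner_diff_right power2_norm_eq_inner\<close>)
  also have "\<dots> = (\<Sum>n\<in>S. inner (y n) (\<Sum>m\<in>S. F (n - m) *v y m)) - (\<Sum>n\<in>S. inner (y n) (\<Sum>m\<in>S. ?I (n - m) *v y m))"
    by (simp add: matrix_vector_mult_diff_rdistrib sum_subtractf inner_diff_right)
  also have "(\<Sum>n\<in>S. inner (y n) (\<Sum>m\<in>S. ?I (n - m) *v y m)) = \<delta> * (\<Sum>n\<in>S. (norm (y n))\<^sup>2)"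
  proof -
    have "(\<Sum>m\<in>S. ?I (n - m) *v y m) = \<delta> *\<^sub>R y n" if "n \<in> S" for n
    proof -
      have "(\<Sum>m\<in>S. ?I (n - m) *v y m) = (\<Sum>m\<in>S. if n = m then \<delta> *\<^sub>R y n else 0)"
        by (intro sum.cong) (auto simp: mat)
      then show ?thesis using fin that by simp
    qed
    then show ?thesis by (simp add: power2_norm_eq_inner sum_distrib_left)
  qed
  finally show ?thesis by simp
qed

lemma norm_matrix_vector_mult_le:
  fixes A :: "complex^'n^'m"
  shows "norm (A *v v) \<le> (\<Sum>i\<in>UNIV. \<Sum>j\<in>UNIV. cmod (A $ i $ j)) * norm v"
proof -
  have "norm (A *v v) \<le> (\<Sum>i\<in>UNIV. cmod ((A *v v) $ i))"
    by (simp add: norm_vec_def L2_set_le_sum)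
  also have "\<dots> \<le> (\<Sum>i\<in>UNIV. \<Sum>j\<in>UNIV. cmod (A $ i $ j) * norm v)"
  proof (rule sum_mono)
    fix i
    have "cmod ((A *v v) $ i) \<le> (\<Sum>j\<in>UNIV. cmod (A $ i $ j * v $ j))"
      unfolding matrix_vector_mult_def by (simp add: norm_sum)
    also have "\<dots> \<le> (\<Sum>j\<in>UNIV. cmod (A $ i $ j) * norm v)"
      by (intro sum_mono) (auto simp: norm_mult intro!: mult_left_mono Finite_Cartesian_Product.norm_nth_le)
    finally show "cmod ((A *v v) $ i) \<le> (\<Sum>j\<in>UNIV. cmod (A $ i $ j) * norm v)" .
  qed
  finally show ?thesis by (simp add: sum_distrib_right)
qed

lemma summable_on_convolution:
  assumes "(\<lambda>n. cmod (c n)) summable_on UNIV" "(\<lambda>n. cmod (d n)) summable_on (UNIV::int set)"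
  shows "(\<lambda>m. c (n - m) * d m) summable_on UNIV"
proof -
  have b: "cmod (c k) \<le> (\<Sum>\<^sub>\<infinity>n. cmod (c n))" for k
    using finite_sum_le_infsum[OF assms(1), of "{k}"] by simp
  have "(\<lambda>m. (\<Sum>\<^sub>\<infinity>n. cmod (c n)) * cmod (d m)) summable_on UNIV"
    using assms(2) by (rule summable_on_cmult_right)
  then have "(\<lambda>m. norm (c (n - m) * d m)) summable_on UNIV"
    by (rule summable_on_comparison_test) (auto simp: norm_mult intro!: mult_right_mono b)
  then show ?thesis by (rule abs_summable_summable)
qed

text \<open>Column \<open>j\<close> of \<open>c\<close> is the half-line solution with right-hand
  side \<open>axis j 1\<close> at index 0. The coefficients of \<open>f g\<close> at negative
  indices stay unconstrained.\<close>

lemma wiener_mat_half_line_inverse: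
  fixes f :: "complex \<Rightarrow> complex^'p^'p"
  assumes F: "wiener_mat F f" and pd: "\<And>z. cmod z = 1 \<Longrightarrow> complex_pos_def (f z)"
  obtains c g where "wiener_mat c g" "\<And>n. n < 0 \<Longrightarrow> c n = 0"
    "\<And>n. 0 \<le> n \<Longrightarrow> conv_mat F c n = (if n = 0 then mat 1 else 0)"
proof -
  obtain \<delta> where \<delta>: "\<delta> > 0" "\<And>z v. cmod z = 1 \<Longrightarrow> \<delta> * (norm v)\<^sup>2 \<le> inner v (f z *v v)"
    using wiener_mat_uniformly_pos_def[OF assms] by blast
  define h where "h n = (\<Sum>i\<in>UNIV. \<Sum>j\<in>UNIV. cmod (F n $ i $ j))" for n
  have h0: "0 \<le> h n" for n by (simp add: h_def sum_nonneg)
  have Fsum: "(\<lambda>n. cmod (F n $ i $ j)) summable_on UNIV" for i j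
    by (rule wiener_coeffsD(1)[OF wiener_matD[OF F]])
  have hsum: "h summable_on UNIV"
    unfolding h_def by (rule wiener_mat_abs_summable[OF F])
  have bound: "norm (F n *v v) \<le> h n * norm v" for n v
    unfolding h_def by (rule norm_matrix_vector_mult_le)
  have coercive: "\<delta> * (\<Sum>n\<in>S. (norm (y n))\<^sup>2) \<le> (\<Sum>n\<in>S. inner (y n) (\<Sum>m\<in>S. F (n - m) *v y m))"
    if "finite S" for S y
    by (rule toeplitz_form_coercive[OF F _ that]) (rule \<delta>(2))
  have "\<exists>x. (\<lambda>n. norm (x n)) summable_on UNIV \<and> (\<forall>n<0. x n = 0) \<and>
      (\<forall>n\<ge>0. ((\<lambda>m. F (n - m) *v x m) has_sum (if n = 0 then axis j 1 else 0)) UNIV)" for j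
    by (rule coercive_half_line_solution[where h = h and a = "\<lambda>n v. F n *v v" and \<delta> = \<delta> and v = "axis j 1",
        OF h0 hsum matrix_vector_mul_linear bound \<delta>(1) coercive]) blast+
  then obtain x where x_sum: "\<And>j. (\<lambda>n. norm (x j n)) summable_on UNIV"
    and x_neg: "\<And>j n. n < 0 \<Longrightarrow> x j n = 0"
    and x_eq: "\<And>j n. 0 \<le> n \<Longrightarrow> ((\<lambda>m. F (n - m) *v x j m) has_sum (if n = 0 then axis j 1 else 0)) UNIV"
    by metis
  define c where "c n = (\<chi> i j. x j n $ i)" for n
  have csum: "(\<lambda>n. cmod (c n $ i $ j)) summable_on UNIV" for i j
    by (rule summable_on_comparison_test[OF x_sum[of j]]) (auto simp: c_def Finite_Cartesian_Product.norm_nth_le)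
  show ?thesis
  proof (rule that)
    show "wiener_mat c (\<lambda>z. \<chi> i j. \<Sum>\<^sub>\<infinity>n. c n $ i $ j * z powi n)"
      unfolding wiener_mat_def wiener_coeffs_def
    proof (intro allI conjI impI csum)
      fix i j and z :: complex assume z: "cmod z = 1"
      have "(\<lambda>n. norm (c n $ i $ j * z powi n)) summable_on UNIV"
        using csum[of i j] by (simp add: norm_mult cmod_powi_circle z)
      then show "((\<lambda>n. c n $ i $ j * z powi n) has_sum (\<chi> i j. \<Sum>\<^sub>\<infinity>n. c n $ i $ j * z powi n) $ i $ j) UNIV"
        by (simp add: abs_summable_summable)
    qed
    show "c n = 0" if "n < 0" for n using x_neg[OF that] by (simp add: c_def vec_eq_iff)
    fix n :: int assume n: "0 \<le> n"
    have "conv_mat F c n $ i $ j = (if n = 0 then mat 1 else 0) $ i $ j" for i j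
    proof -
      have "((\<lambda>m. (F (n - m) *v x j m) $ i) has_sum (if n = 0 then axis j 1 else 0) $ i) UNIV"
        by (rule has_sum_bounded_linear[OF bounded_linear_vec_nth x_eq[OF n], unfolded o_def])
      then have "((\<lambda>m. \<Sum>k\<in>UNIV. F (n - m) $ i $ k * c m $ k $ j) has_sum (if n = 0 then mat 1 else 0) $ i $ j) UNIV"
        by (cases "n = 0") (simp_all add: matrix_vector_mult_def c_def axis_def mat_def)
      moreover have "((\<lambda>m. \<Sum>k\<in>UNIV. F (n - m) $ i $ k * c m $ k $ j) has_sum
          (\<Sum>k\<in>UNIV. \<Sum>\<^sub>\<infinity>m. F (n - m) $ i $ k * c m $ k $ j)) UNIV"
        by (intro has_sum_sum has_sum_infsum summable_on_convolution Fsum csum)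
      ultimately show ?thesis unfolding conv_mat_def using has_sum_unique by fastforce
    qed
    then show "conv_mat F c n = (if n = 0 then mat 1 else 0)" by (simp add: vec_eq_iff)
  qed
qed

text \<open>With \<open>c\<close>, \<open>g\<close> as in the previous lemma, \<open>f g\<close> has no positive Fourier coefficients, hence neither has
  \<open>g\<^sup>* f g\<close>; being Hermitian, it is a constant \<open>D\<close>. If \<open>U\<^sup>* D U = 1\<close>, then \<open>k = f g U\<close> satisfies
  \<open>(g U)\<^sup>* k = 1\<close>, and so \<open>k k\<^sup>* = f (g U) k\<^sup>* = f\<close>.\<close>

lemma wiener_mat_minus_factorization:
  fixes f :: "complex \<Rightarrow> complex^'p^'p"
  assumes F: "wiener_mat F f" and pd: "\<And>z. cmod z = 1 \<Longrightarrow> complex_pos_def (f z)"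
  obtains c :: "int \<Rightarrow> complex^'p^'p" and g :: "complex \<Rightarrow> complex^'p^'p"
    and d :: "int \<Rightarrow> complex^'p^'p" and k :: "complex \<Rightarrow> complex^'p^'p"
  where "wiener_mat c g" "\<And>n. n < 0 \<Longrightarrow> c n = 0"
    "wiener_mat d k" "\<And>n. n > 0 \<Longrightarrow> d n = 0"
    "\<And>z. cmod z = 1 \<Longrightarrow> cadjoint (g z) ** k z = mat 1"
    "\<And>z. cmod z = 1 \<Longrightarrow> f z = k z ** cadjoint (k z)"
proof -
  obtain c g where c: "wiener_mat c g" "\<And>n. n < 0 \<Longrightarrow> c n = 0"
    "\<And>n. 0 \<le> n \<Longrightarrow> conv_mat F c n = (if n = 0 then mat 1 else 0)"
    using wiener_mat_half_line_inverse[OF assms] by blast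
  define d where "d = conv_mat F c"
  have d: "wiener_mat d (\<lambda>z. f z ** g z)" unfolding d_def by (intro wiener_mat_mult F c)
  have d0: "d 0 = mat 1" and dpos: "\<And>n. n > 0 \<Longrightarrow> d n = 0" by (simp_all add: d_def c(3))
  define E where "E = conv_mat (\<lambda>n. cadjoint (c (- n))) d"
  have E: "wiener_mat E (\<lambda>z. cadjoint (g z) ** (f z ** g z))"
    unfolding E_def by (intro wiener_mat_mult wiener_mat_cadjoint c d)
  have Epos: "E n = 0" if "n > 0" for n
    unfolding E_def by (rule conv_mat_zero_of_pos) (use that c(2) dpos in \<open>auto simp: vec_eq_iff\<close>)
  have "E n = cadjoint (E (- n))" for n
    by (rule wiener_mat_unique[OF E wiener_mat_cadjoint[OF E]])
      (simp add: cadjoint_mult complex_pos_def_hermitian pd matrix_mul_assoc)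
  then have Eneg: "E n = 0" if "n < 0" for n
    using that Epos[of "- n"] cadjoint_zero by (metis neg_0_less_iff_less)
  define D where "D = E 0"
  have "E n = 0" if "n \<noteq> 0" for n using that Epos Eneg by (meson linorder_neqE)
  then have D: "cadjoint (g z) ** (f z ** g z) = D" if "cmod z = 1" for z
    unfolding D_def by (rule wiener_mat_constant[OF E _ that])
  have "complex_pos_def D"
    unfolding complex_pos_def_cdot
  proof (intro allI impI)
    fix v :: "complex^'p" assume v: "v \<noteq> 0"
    \<comment> \<open>If \<open>g z *v v\<close> vanished on the whole circle, so would every
      coefficient of \<open>f g\<close> applied to \<open>v\<close>; but the one at index 0 is the
      identity, giving \<open>v = 0\<close>.\<close>
    have "\<exists>z. cmod z = 1 \<and> g z *v v \<noteq> 0"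
    proof (rule ccontr)
      assume "\<not> ?thesis"
      then have gz: "(f z ** g z) *v v = 0" if "cmod z = 1" for z
        using that by (simp flip: matrix_vector_mul_assoc)
      have "v $ i = 0" for i
      proof -
        have "wiener_coeffs (\<lambda>n. \<Sum>j\<in>UNIV. v $ j * d n $ i $ j) (\<lambda>z. \<Sum>j\<in>UNIV. v $ j * (f z ** g z) $ i $ j)"
          by (intro wiener_coeffs_sum wiener_coeffs_cmult wiener_matD[OF d])
        then have "(\<Sum>j\<in>UNIV. v $ j * d 0 $ i $ j) = 0"
        proof (rule wiener_coeffs_zero_unique)
          fix z :: complex assume "cmod z = 1"
          from arg_cong[OF gz[OF this], of "\<lambda>w. w $ i"]
          show "(\<Sum>j\<in>UNIV. v $ j * (f z ** g z) $ i $ j) = 0"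
            by (simp add: matrix_vector_mult_def mult.commute)
        qed
        then show ?thesis by (simp add: d0 mat_def if_distrib[of "\<lambda>x. _ * x"] cong: if_cong)
      qed
      with v show False by (simp add: vec_eq_iff)
    qed
    then obtain z where z: "cmod z = 1" "g z *v v \<noteq> 0" by blast
    have "cdot v (D *v v) = cdot (g z *v v) (f z *v (g z *v v))"
      unfolding D[OF z(1), symmetric] by (simp add: cdot_matrix_adjoint flip: matrix_vector_mul_assoc)
    then show "cdot v (D *v v) \<in> \<real> \<and> 0 < Re (cdot v (D *v v))"
      using pd[OF z(1)] z(2) by (simp add: complex_pos_def_cdot)
  qed
  then obtain U :: "complex^'p^'p" where U: "cadjoint U ** D ** U = mat 1" by (rule complex_pos_def_gram_schmidt)
  define V where "V z = g z ** U" for z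
  define k where "k z = (f z ** g z) ** U" for z
  have Vk: "cadjoint (V z) ** k z = mat 1" if "cmod z = 1" for z
  proof -
    have "cadjoint (V z) ** k z = cadjoint U ** (cadjoint (g z) ** (f z ** g z)) ** U"
      by (simp add: V_def k_def cadjoint_mult matrix_mul_assoc)
    then show ?thesis using U D[OF that] by simp
  qed
  show ?thesis
  proof (rule that)
    show "wiener_mat (\<lambda>n. c n ** U) V" unfolding V_def by (rule wiener_mat_mult_const[OF c(1)])
    show "wiener_mat (\<lambda>n. d n ** U) k" unfolding k_def by (rule wiener_mat_mult_const[OF d])
    show "c n ** U = 0" if "n < 0" for n by (simp add: c(2)[OF that] matrix_matrix_mult_def vec_eq_iff)
    show "d n ** U = 0" if "n > 0" for n by (simp add: dpos[OF that] matrix_matrix_mult_def vec_eq_iff)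
    fix z :: complex assume z: "cmod z = 1"
    show "cadjoint (V z) ** k z = mat 1" by (rule Vk[OF z])
    from arg_cong[OF Vk[OF z], of cadjoint] have "cadjoint (k z) ** V z = mat 1"
      by (simp add: cadjoint_mult)
    then have "V z ** cadjoint (k z) = mat 1" by (simp add: matrix_left_right_inverse)
    then have "f z ** (V z ** cadjoint (k z)) = f z" by simp
    then show "f z = k z ** cadjoint (k z)" by (simp add: k_def V_def matrix_mul_assoc)
  qed
qed

theorem wiener_mat_spectral_factorization:
  fixes f :: "complex \<Rightarrow> complex^'p^'p"
  assumes F: "wiener_mat F f" and pd: "\<And>z. cmod z = 1 \<Longrightarrow> complex_pos_def (f z)"
  obtains c :: "int \<Rightarrow> complex^'p^'p" and g :: "complex \<Rightarrow> complex^'p^'p"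
    and d :: "int \<Rightarrow> complex^'p^'p" and k :: "complex \<Rightarrow> complex^'p^'p"
  where "wiener_mat c g" "\<And>n. n < 0 \<Longrightarrow> c n = 0"
    "wiener_mat d k" "\<And>n. n < 0 \<Longrightarrow> d n = 0"
    "\<And>z. cmod z = 1 \<Longrightarrow> g z ** k z = mat 1"
    "\<And>z. cmod z = 1 \<Longrightarrow> k z ** g z = mat 1"
    "\<And>z. cmod z = 1 \<Longrightarrow> f z = g z ** cadjoint (g z)"
proof -
  \<comment> \<open>Reflecting \<open>f\<close> turns the factor without positive coefficients into one without negative ones.\<close>
  have pd': "complex_pos_def (f (cnj z))" if "cmod z = 1" for z
    using that by (intro pd) simp
  show ?thesis
  proof (rule wiener_mat_minus_factorization[OF wiener_mat_reflect[OF F] pd'])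
    fix c d :: "int \<Rightarrow> complex^'p^'p" and g k :: "complex \<Rightarrow> complex^'p^'p"
    assume c: "wiener_mat c g" "\<And>n. n < 0 \<Longrightarrow> c n = 0"
      and d: "wiener_mat d k" "\<And>n. n > 0 \<Longrightarrow> d n = 0"
      and 1: "\<And>z. cmod z = 1 \<Longrightarrow> cadjoint (g z) ** k z = mat 1"
      and 2: "\<And>z. cmod z = 1 \<Longrightarrow> f (cnj z) = k z ** cadjoint (k z)"
    show ?thesis
    proof (rule that)
      show "wiener_mat (\<lambda>n. d (- n)) (\<lambda>z. k (cnj z))" by (rule wiener_mat_reflect[OF d(1)])
      \<comment> \<open>Reflection and adjunction each reverse the index. The two reversals cancel,
        so the inverse factor keeps the one-sidedness of \<open>c\<close>.\<close>
      show "wiener_mat (\<lambda>n. cadjoint (c n)) (\<lambda>z. cadjoint (g (cnj z)))"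
        using wiener_mat_cadjoint[OF wiener_mat_reflect[OF c(1)]] by simp
      show "d (- n) = 0" if "n < 0" for n using that by (simp add: d(2))
      show "cadjoint (c n) = 0" if "n < 0" for n using that by (simp add: c(2) vec_eq_iff)
      fix z :: complex assume z: "cmod z = 1"
      then have z': "cmod (cnj z) = 1" by simp
      show "cadjoint (g (cnj z)) ** k (cnj z) = mat 1" by (rule 1[OF z'])
      then show "k (cnj z) ** cadjoint (g (cnj z)) = mat 1" by (simp add: matrix_left_right_inverse)
      show "f z = k (cnj z) ** cadjoint (k (cnj z))" using 2[OF z'] by simp
    qed
  qed auto
qed

section \<open>Transfer to bicomplex matrices\<close>

lemma bc_lam_scaleR: "bc_lam1 (r *\<^sub>R Z) = r *\<^sub>R bc_lam1 Z" "bc_lam2 (r *\<^sub>R Z) = r *\<^sub>R bc_lam2 Z"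
  by (simp_all add: scaleR_bicomplex_def bc_lam1_def bc_lam2_def algebra_simps)

lemma bounded_linear_bc_lam1: "bounded_linear bc_lam1"
  by (rule bounded_linear_intro[of _ 1]) (simp_all add: norm_bicomplex_def bc_lam_scaleR)

lemma bounded_linear_bc_lam2: "bounded_linear bc_lam2"
  by (rule bounded_linear_intro[of _ 1]) (simp_all add: norm_bicomplex_def bc_lam_scaleR)

lemma bc_lam_sum:
  "bc_lam1 (\<Sum>i\<in>I. x i) = (\<Sum>i\<in>I. bc_lam1 (x i))" "bc_lam2 (\<Sum>i\<in>I. x i) = (\<Sum>i\<in>I. bc_lam2 (x i))"
  by (simp_all add: linear_sum bounded_linear.linear bounded_linear_bc_lam1 bounded_linear_bc_lam2)

lemma bc_lam_inverse:
  assumes "bc_lam1 Z \<noteq> 0" "bc_lam2 Z \<noteq> 0"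
  shows "bc_lam1 (inverse Z) = inverse (bc_lam1 Z)" "bc_lam2 (inverse Z) = inverse (bc_lam2 Z)"
  using arg_cong[OF bc_inverse_right[OF assms], of bc_lam1] arg_cong[OF bc_inverse_right[OF assms], of bc_lam2]
  by (simp_all add: inverse_unique)

lemma bc_lam_power: "bc_lam1 (Z ^ n) = bc_lam1 Z ^ n" "bc_lam2 (Z ^ n) = bc_lam2 Z ^ n"
  by (induction n) simp_all

lemma bc_lam_powi:
  assumes "Z \<in> bc_circle"
  shows "bc_lam1 (Z powi n) = bc_lam1 Z powi n" "bc_lam2 (Z powi n) = bc_lam2 Z powi n"
proof -
  have "bc_lam1 Z \<noteq> 0" "bc_lam2 Z \<noteq> 0" using bc_circle_norm1[OF assms] by auto
  then show "bc_lam1 (Z powi n) = bc_lam1 Z powi n" "bc_lam2 (Z powi n) = bc_lam2 Z powi n"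
    by (simp_all add: power_int_def bc_lam_power bc_lam_inverse)
qed

text \<open>The choice \<open>s = 0\<close> in \<open>bc_circle\<close>: these points have equal
  idempotent components, so one evaluation there reads off both complex problems at the same
  \<open>a\<close>.\<close>

lemma bc_of_complex_circle:
  assumes "cmod a = 1"
  shows "bc_of_complex a \<in> bc_circle" "bc_lam1 (bc_of_complex a) = a" "bc_lam2 (bc_of_complex a) = a"
proof -
  have "a = cis (Arg2pi a)"
    using Arg2pi_eq[of a] assms by (simp add: cis_conv_exp)
  then have "bc_of_complex a = bc_of_complex (cis (Arg2pi a)) * Bicomplex (of_real (cos 0)) (of_real (sin 0))"
    by (simp add: bicomplex_eq_iff)
  moreover have "Arg2pi a \<in> {0..2 * pi}"
    using Arg2pi_ge_0[of a] Arg2pi_lt_2pi[of a] by simp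
  moreover have "(0::real) \<in> {0..2 * pi}" by simp
  ultimately show "bc_of_complex a \<in> bc_circle"
    unfolding bc_circle_def by blast
qed (simp_all add: bc_of_complex_def bc_lam1_def bc_lam2_def)

definition bc_join :: "complex \<Rightarrow> complex \<Rightarrow> bicomplex"
  where "bc_join a b = bc_of_complex a * bc_e1 + bc_of_complex b * bc_e2"

lemma bc_lam_join [simp]: "bc_lam1 (bc_join a b) = a" "bc_lam2 (bc_join a b) = b"
  by (simp_all only: bc_join_def bc_idempotent_unique)

lemma bounded_linear_bc_join_left: "bounded_linear (\<lambda>a. bc_join a 0)"
  by (rule bounded_linear_intro[of _ 1]) (simp_all add: bc_eq_iff_lam norm_bicomplex_def bc_lam_scaleR)

lemma bounded_linear_bc_join_right: "bounded_linear (\<lambda>b. bc_join 0 b)"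
  by (rule bounded_linear_intro[of _ 1]) (simp_all add: bc_eq_iff_lam norm_bicomplex_def bc_lam_scaleR)

definition bc_mat_join :: "complex^'n^'m \<Rightarrow> complex^'n^'m \<Rightarrow> bicomplex^'n^'m"
  where "bc_mat_join A B = (\<chi> i j. bc_join (A $ i $ j) (B $ i $ j))"

lemma bc_mat_nth [simp]: "bc_mat1 M $ i $ j = bc_lam1 (M $ i $ j)" "bc_mat2 M $ i $ j = bc_lam2 (M $ i $ j)"
  by (simp_all add: bc_mat1_def bc_mat2_def)

lemma bc_mat_join_components [simp]: "bc_mat1 (bc_mat_join A B) = A" "bc_mat2 (bc_mat_join A B) = B"
  by (simp_all add: vec_eq_iff bc_mat_join_def)

lemma bc_mat_eqI: "bc_mat1 M = bc_mat1 N \<Longrightarrow> bc_mat2 M = bc_mat2 N \<Longrightarrow> M = N"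
  by (simp add: vec_eq_iff bc_eq_iff_lam)

lemma bc_mat_mult: "bc_mat1 (M ** N) = bc_mat1 M ** bc_mat1 N" "bc_mat2 (M ** N) = bc_mat2 M ** bc_mat2 N"
  by (simp_all add: vec_eq_iff matrix_matrix_mult_def bc_lam_sum)

lemma bc_mat_mat_1: "bc_mat1 (mat 1) = mat 1" "bc_mat2 (mat 1) = mat 1"
  by (simp_all add: vec_eq_iff mat_def)

lemma bc_mat_adjoint: "bc_mat1 (bc_adjoint M) = cadjoint (bc_mat1 M)" "bc_mat2 (bc_adjoint M) = cadjoint (bc_mat2 M)"
  by (simp_all add: vec_eq_iff bc_adjoint_def transpose_def bc_lam_cnj)

text \<open>The two bounds translate between summability of operator norms and entrywise
  summability, one for each direction of the transfer.\<close>

lemma onorm_complex_matrix_bounds: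
  fixes A :: "complex^'n^'m"
  shows "cmod (A $ i $ j) \<le> onorm ((*v) A)"
    and "onorm ((*v) A) \<le> (\<Sum>i\<in>UNIV. \<Sum>j\<in>UNIV. cmod (A $ i $ j))"
proof -
  have "cmod (A $ i $ j) = cmod ((A *v axis j 1) $ i)"
    by (simp add: matrix_vector_mult_def axis_def if_distrib[of "\<lambda>x. _ * x"] cong: if_cong)
  also have "\<dots> \<le> norm (A *v axis j 1)" by (rule Finite_Cartesian_Product.norm_nth_le)
  also have "\<dots> \<le> onorm ((*v) A) * norm (axis j 1 :: complex^'n)"
    by (rule onorm) simp
  finally show "cmod (A $ i $ j) \<le> onorm ((*v) A)" by simp
  show "onorm ((*v) A) \<le> (\<Sum>i\<in>UNIV. \<Sum>j\<in>UNIV. cmod (A $ i $ j))"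
    by (rule onorm_bound) (auto intro!: norm_matrix_vector_mult_le sum_nonneg)
qed

section \<open>Splitting and recombining bicomplex Wiener series\<close>

lemma has_sum_vec_nth: "(x has_sum l) A \<Longrightarrow> ((\<lambda>n. x n $ i) has_sum l $ i) A"
  unfolding has_sum_def by (drule tendsto_vec_nth[where i = i]) simp

lemma has_sum_vecI:
  assumes "\<And>i. ((\<lambda>n. x n $ i) has_sum l $ i) A"
  shows "(x has_sum l) A"
  unfolding has_sum_def
  by (rule vec_tendstoI) (use assms in \<open>simp add: has_sum_def\<close>)

text \<open>\<open>bc_lam1\<close> and \<open>bc_lam2\<close> are bounded and multiplicative, so
  each maps the bicomplex series to a complex one in its own variable. Uniqueness of sums then shows
  that a component of \<open>f Z\<close> ignores the other variable.\<close>

lemma wiener_series_components: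
  assumes "wiener_series c f"
  shows "wiener_mat (\<lambda>n. bc_mat1 (c n)) (\<lambda>a. bc_mat1 (f (bc_of_complex a)))" (is ?W1)
    and "wiener_mat (\<lambda>n. bc_mat2 (c n)) (\<lambda>a. bc_mat2 (f (bc_of_complex a)))" (is ?W2)
    and "Z \<in> bc_circle \<Longrightarrow> bc_mat1 (f Z) = bc_mat1 (f (bc_of_complex (bc_lam1 Z)))"
    and "Z \<in> bc_circle \<Longrightarrow> bc_mat2 (f Z) = bc_mat2 (f (bc_of_complex (bc_lam2 Z)))"
proof -
  have sum: "(\<lambda>n. bc_mat_norm (c n)) summable_on UNIV"
    and ser: "\<And>Z. Z \<in> bc_circle \<Longrightarrow> ((\<lambda>n. map_matrix (\<lambda>a. a * Z powi n) (c n)) has_sum f Z) UNIV"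
    using assms by (auto simp: wiener_series_def)
  have bound: "cmod (bc_mat1 (c n) $ i $ j) \<le> bc_mat_norm (c n)" "cmod (bc_mat2 (c n) $ i $ j) \<le> bc_mat_norm (c n)" for n i j
    using onorm_complex_matrix_bounds(1)[of "bc_mat1 (c n)" i j] onorm_complex_matrix_bounds(1)[of "bc_mat2 (c n)" i j]
      onorm_pos_le[of "(*v) (bc_mat1 (c n))"] onorm_pos_le[of "(*v) (bc_mat2 (c n))"]
    unfolding bc_mat_norm_def by auto
  have entry: "((\<lambda>n. c n $ i $ j * Z powi n) has_sum f Z $ i $ j) UNIV" if "Z \<in> bc_circle" for Z i j
    using has_sum_vec_nth[OF has_sum_vec_nth[OF ser[OF that]], of i j] by simp
  have 1: "((\<lambda>n. bc_mat1 (c n) $ i $ j * bc_lam1 Z powi n) has_sum bc_mat1 (f Z) $ i $ j) UNIV"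
    and 2: "((\<lambda>n. bc_mat2 (c n) $ i $ j * bc_lam2 Z powi n) has_sum bc_mat2 (f Z) $ i $ j) UNIV"
    if "Z \<in> bc_circle" for Z i j
    using has_sum_bounded_linear[OF bounded_linear_bc_lam1 entry[OF that, of i j]]
      has_sum_bounded_linear[OF bounded_linear_bc_lam2 entry[OF that, of i j]]
    by (simp_all add: o_def bc_lam_powi that)
  show ?W1 ?W2
    unfolding wiener_mat_def wiener_coeffs_def
    using summable_on_comparison_test[OF sum] bound 1[OF bc_of_complex_circle(1)] 2[OF bc_of_complex_circle(1)]
    by (simp_all add: bc_of_complex_circle)
  assume Z: "Z \<in> bc_circle"
  note norms = bc_circle_norm1[OF Z]
  have "bc_mat1 (f Z) $ i $ j = bc_mat1 (f (bc_of_complex (bc_lam1 Z))) $ i $ j" for i j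
    using has_sum_unique[OF 1[OF Z]] 1[OF bc_of_complex_circle(1)[OF norms(1)]]
    by (simp add: bc_of_complex_circle(2)[OF norms(1)])
  then show "bc_mat1 (f Z) = bc_mat1 (f (bc_of_complex (bc_lam1 Z)))" by (simp only: vec_eq_iff) simp
  have "bc_mat2 (f Z) $ i $ j = bc_mat2 (f (bc_of_complex (bc_lam2 Z))) $ i $ j" for i j
    using has_sum_unique[OF 2[OF Z]] 2[OF bc_of_complex_circle(1)[OF norms(2)]]
    by (simp add: bc_of_complex_circle(3)[OF norms(2)])
  then show "bc_mat2 (f Z) = bc_mat2 (f (bc_of_complex (bc_lam2 Z)))" by (simp only: vec_eq_iff) simp
qed

lemma wiener_series_join:
  fixes c1 c2 :: "int \<Rightarrow> complex^'p^'p"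
  assumes 1: "wiener_mat c1 g1" and 2: "wiener_mat c2 g2"
    and f: "\<And>Z. Z \<in> bc_circle \<Longrightarrow> f Z = bc_mat_join (g1 (bc_lam1 Z)) (g2 (bc_lam2 Z))"
  shows "wiener_series (\<lambda>n. bc_mat_join (c1 n) (c2 n)) f"
  unfolding wiener_series_def
proof (intro conjI ballI)
  have "(\<lambda>n. (\<Sum>i\<in>UNIV. \<Sum>j\<in>UNIV. cmod (c1 n $ i $ j)) + (\<Sum>i\<in>UNIV. \<Sum>j\<in>UNIV. cmod (c2 n $ i $ j))) summable_on UNIV"
    by (intro summable_on_add wiener_mat_abs_summable[OF 1] wiener_mat_abs_summable[OF 2])
  then show "(\<lambda>n. bc_mat_norm (bc_mat_join (c1 n) (c2 n))) summable_on UNIV"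
    by (rule summable_on_comparison_test)
       (auto simp: bc_mat_norm_def intro!: add_mono onorm_complex_matrix_bounds(2) add_nonneg_nonneg onorm_pos_le)
  fix Z assume Z: "Z \<in> bc_circle"
  show "((\<lambda>n. map_matrix (\<lambda>a. a * Z powi n) (bc_mat_join (c1 n) (c2 n))) has_sum f Z) UNIV"
  proof (intro has_sum_vecI)
    fix i j
    \<comment> \<open>A joined value is split as \<open>bc_join a 0 + bc_join 0 b\<close>, so that
      each complex series passes through a bounded linear map of one argument.\<close>
    have "((\<lambda>n. bc_join (c1 n $ i $ j * bc_lam1 Z powi n) 0 + bc_join 0 (c2 n $ i $ j * bc_lam2 Z powi n)) has_sum
        bc_join (g1 (bc_lam1 Z) $ i $ j) 0 + bc_join 0 (g2 (bc_lam2 Z) $ i $ j)) UNIV"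
      by (intro has_sum_add
          has_sum_bounded_linear[OF bounded_linear_bc_join_left, unfolded o_def]
          has_sum_bounded_linear[OF bounded_linear_bc_join_right, unfolded o_def]
          wiener_coeffsD(2)[OF wiener_matD] 1 2 bc_circle_norm1 Z)
    also have "(\<lambda>n. bc_join (c1 n $ i $ j * bc_lam1 Z powi n) 0 + bc_join 0 (c2 n $ i $ j * bc_lam2 Z powi n)) =
        (\<lambda>n. map_matrix (\<lambda>a. a * Z powi n) (bc_mat_join (c1 n) (c2 n)) $ i $ j)"
      by (simp add: fun_eq_iff bc_eq_iff_lam bc_mat_join_def bc_lam_powi Z)
    also have "bc_join (g1 (bc_lam1 Z) $ i $ j) 0 + bc_join 0 (g2 (bc_lam2 Z) $ i $ j) = f Z $ i $ j"
      by (simp add: f[OF Z] bc_eq_iff_lam bc_mat_join_def)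
    finally show "((\<lambda>n. map_matrix (\<lambda>a. a * Z powi n) (bc_mat_join (c1 n) (c2 n)) $ i $ j) has_sum f Z $ i $ j) UNIV" .
  qed
qed

lemma wiener_plus_join:
  fixes c1 c2 :: "int \<Rightarrow> complex^'p^'p"
  assumes "wiener_mat c1 g1" "\<And>n. n < 0 \<Longrightarrow> c1 n = 0" "wiener_mat c2 g2" "\<And>n. n < 0 \<Longrightarrow> c2 n = 0"
    and "\<And>Z. Z \<in> bc_circle \<Longrightarrow> f Z = bc_mat_join (g1 (bc_lam1 Z)) (g2 (bc_lam2 Z))"
  shows "f \<in> wiener_plus"
proof -
  have "bc_mat_join (c1 n) (c2 n) = 0" if "n < 0" for n
    using that by (simp add: assms(2,4) vec_eq_iff bc_mat_join_def bc_eq_iff_lam)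
  with wiener_series_join[OF assms(1,3,5)] show ?thesis unfolding wiener_plus_def by blast
qed

text \<open>\<open>matrix_inv\<close> is an arbitrary choice among two-sided inverses; associativity
  leaves only one candidate.\<close>

lemma matrix_inv_eqI:
  fixes A B :: "'a::semiring_1^'n^'n"
  assumes "A ** B = mat 1" "B ** A = mat 1"
  shows "matrix_inv A = B"
proof -
  have "A ** matrix_inv A = mat 1 \<and> matrix_inv A ** A = mat 1"
    unfolding matrix_inv_def by (rule someI[of _ B]) (simp add: assms)
  then show ?thesis by (metis assms(2) matrix_mul_assoc matrix_mul_lid matrix_mul_rid)
qed

theorem theorem1p22:
  fixes f :: "bicomplex \<Rightarrow> bicomplex^'p^'p"
  assumes "f \<in> wiener"
    and "\<forall>Z\<in>bc_circle. bc_pos_def (f Z)"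
  shows "\<exists>f_plus :: bicomplex \<Rightarrow> bicomplex^'p^'p.
    f_plus \<in> wiener_plus \<and>
    (\<forall>Z\<in>bc_circle. invertible (f_plus Z)) \<and>
    (\<lambda>Z. matrix_inv (f_plus Z)) \<in> wiener_plus \<and>
    (\<forall>Z\<in>bc_circle. f Z = f_plus Z ** bc_adjoint (f_plus Z))"
proof -
  obtain c where c: "wiener_series c f" using assms(1) by (auto simp: wiener_def)
  note comp = wiener_series_components[OF c]
  have pd: "complex_pos_def (bc_mat1 (f (bc_of_complex a)))" "complex_pos_def (bc_mat2 (f (bc_of_complex a)))"
    if "cmod a = 1" for a
    using assms(2) bc_of_complex_circle(1)[OF that] by (auto simp: bc_pos_def_def)
  show ?thesis
  proof (rule wiener_mat_spectral_factorization[OF comp(1) pd(1)], assumption,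
      rule wiener_mat_spectral_factorization[OF comp(2) pd(2)], assumption)
    fix c1 d1 c2 d2 :: "int \<Rightarrow> complex^'p^'p" and g1 k1 g2 k2 :: "complex \<Rightarrow> complex^'p^'p"
    assume g1: "wiener_mat c1 g1" "\<And>n. n < 0 \<Longrightarrow> c1 n = 0"
      and k1: "wiener_mat d1 k1" "\<And>n. n < 0 \<Longrightarrow> d1 n = 0"
      and inv1: "\<And>a. cmod a = 1 \<Longrightarrow> g1 a ** k1 a = mat 1" "\<And>a. cmod a = 1 \<Longrightarrow> k1 a ** g1 a = mat 1"
      and f1: "\<And>a. cmod a = 1 \<Longrightarrow> bc_mat1 (f (bc_of_complex a)) = g1 a ** cadjoint (g1 a)"
      and g2: "wiener_mat c2 g2" "\<And>n. n < 0 \<Longrightarrow> c2 n = 0"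
      and k2: "wiener_mat d2 k2" "\<And>n. n < 0 \<Longrightarrow> d2 n = 0"
      and inv2: "\<And>a. cmod a = 1 \<Longrightarrow> g2 a ** k2 a = mat 1" "\<And>a. cmod a = 1 \<Longrightarrow> k2 a ** g2 a = mat 1"
      and f2: "\<And>a. cmod a = 1 \<Longrightarrow> bc_mat2 (f (bc_of_complex a)) = g2 a ** cadjoint (g2 a)"
    define f_plus where "f_plus Z = bc_mat_join (g1 (bc_lam1 Z)) (g2 (bc_lam2 Z))" for Z
    define f_inv where "f_inv Z = bc_mat_join (k1 (bc_lam1 Z)) (k2 (bc_lam2 Z))" for Z
    have inv: "f_plus Z ** f_inv Z = mat 1" "f_inv Z ** f_plus Z = mat 1" if "Z \<in> bc_circle" for Z
      using inv1 inv2 bc_circle_norm1[OF that]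
      by (auto simp: f_plus_def f_inv_def bc_mat_mult bc_mat_mat_1 intro!: bc_mat_eqI)
    show ?thesis
    proof (intro exI[of _ f_plus] conjI ballI)
      show "f_plus \<in> wiener_plus" by (rule wiener_plus_join[OF g1 g2]) (simp_all add: f_plus_def)
      \<comment> \<open>Membership in \<open>wiener_plus\<close> concerns values on the circle only,
        and there \<open>matrix_inv (f_plus Z)\<close> is \<open>f_inv Z\<close>.\<close>
      show "(\<lambda>Z. matrix_inv (f_plus Z)) \<in> wiener_plus"
        by (rule wiener_plus_join[OF k1 k2]) (simp_all add: matrix_inv_eqI[OF inv] f_inv_def)
      fix Z assume Z: "Z \<in> bc_circle"
      show "invertible (f_plus Z)" using inv[OF Z] by (auto simp: invertible_def)
      show "f Z = f_plus Z ** bc_adjoint (f_plus Z)"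
        using comp(3,4)[OF Z] f1 f2 bc_circle_norm1[OF Z]
        by (intro bc_mat_eqI) (simp_all add: f_plus_def bc_mat_mult bc_mat_adjoint)
    qed
  qed
qed

end
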